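(* Let $C$ be the non-complete intersection Gorenstein monomial curve $x_i=t^{n_i}$ ($1\le i\le4$) in $\mathbb{A}^4(K)$, with $n_1<n_2<n_3<n_4$. Suppose that $I(C)$ is given as in case 2(b), i.e. $I(C)$ is minimally generated by $$f_1=x_1^{a_1}-x_2^{a_{12}}x_3^{a_{13}},\quad f_2=x_2^{a_2}-x_1^{a_{21}}x_4^{a_{24}},\quad f_3=x_3^{a_3}-x_2^{a_{32}}x_4^{a_{34}},$$ $$f_4=x_4^{a_4}-x_1^{a_{41}}x_3^{a_{43}},\quad f_5=x_1^{a_{41}}x_2^{a_{32}}-x_3^{a_{13}}x_4^{a_{24}},$$ and also that $a_{24}\le a_{34}$. Then $C$ has Cohen-Macaulay tangent cone at the origin if and only if (1) $a_2\le a_{21}+a_{24}$, and (2) either $a_{32}<a_{12}$ and $a_3+a_{13}\le a_{41}+2a_{32}+a_{34}-a_{24}$, or $a_{12}\le a_{32}$ and $a_3+a_{13}\le a_1+a_{32}-a_{12}+a_{34}$.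
   Context: $K$ is a field and $n_1,\dots,n_4$ are positive integers with $\gcd(n_1,\dots,n_4)=1$. $I(C)$ is the kernel of the $K$-algebra homomorphism $K[x_1,\dots,x_4]\to K[t]$, $x_i\mapsto t^{n_i}$. $C$ is Gorenstein if the semigroup $\mathcal{S}=\{g_1n_1+\cdots+g_4n_4: g_i\in\mathbb{N}\}$ is symmetric ($\mathbb{N}$ = non-negative integers). In the description of $I(C)$, all exponents are integers with $0<a_{ij}<a_j$, and (by Bresinsky) $a_1=a_{21}+a_{41}$, $a_2=a_{12}+a_{32}$, $a_3=a_{13}+a_{43}$, $a_4=a_{24}+a_{34}$. $C$ has Cohen-Macaulay tangent cone at the origin if the ring $K[x_1,\dots,x_4]/I(C)_*$ is Cohen-Macaulay, where $I(C)_*$ is generated by the homogeneous (standard grading) summands $f_*$ of least degree of the polynomials $f\in I(C)$. *)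

theory Defs
  imports
    "HOL-Algebra.Algebraic_Closure_Type"
    "HOL-Library.Poly_Mapping"
    "HOL-Library.Numeral_Type"
    "HOL-Library.Extended_Nat"
begin

section \<open>Commutative algebra\<close>

text \<open>
  The second conjunct says that the \<open>i\<close>-th entry is a nonzerodivisor modulo the ideal
  generated by the preceding ones (positions are counted from \<open>0\<close>).
\<close>

definition regular_sequence :: "('a, 'b) ring_scheme \<Rightarrow> 'a list \<Rightarrow> bool" where
  "regular_sequence R xs \<longleftrightarrow>
     set xs \<subseteq> carrier R \<and>
     (\<forall>i<length xs. \<forall>y\<in>carrier R.
        xs ! i \<otimes>\<^bsub>R\<^esub> y \<in> genideal R (set (take i xs)) \<longrightarrow> y \<in> genideal R (set (take i xs))) \<and>
     genideal R (set xs) \<noteq> carrier R"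

definition ideal_depth :: "('a, 'b) ring_scheme \<Rightarrow> 'a set \<Rightarrow> enat" where
  "ideal_depth R I = (SUP xs\<in>{xs. regular_sequence R xs \<and> set xs \<subseteq> I}. enat (length xs))"

text \<open>The height (codimension) of a prime ideal; used for prime \<open>P\<close> only.\<close>

definition prime_height :: "('a, 'b) ring_scheme \<Rightarrow> 'a set \<Rightarrow> enat" where
  "prime_height R P =
     (SUP n\<in>{n. \<exists>c :: nat \<Rightarrow> 'a set.
                (\<forall>i\<le>n. primeideal (c i) R) \<and> (\<forall>i<n. c i \<subset> c (Suc i)) \<and> c n = P}. enat n)"

text \<open>
  Cohen--Macaulay rings, not necessarily local, as defined in Eisenbud, Commutative Algebra with a
  View Toward Algebraic Geometry, Section 18.2: a Noetherian commutative ring in which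
  depth and codimension agree for every maximal ideal.
\<close>

definition Cohen_Macaulay :: "('a, 'b) ring_scheme \<Rightarrow> bool" where
  "Cohen_Macaulay R \<longleftrightarrow>
     cring R \<and> noetherian_ring R \<and>
     (\<forall>M. maximalideal M R \<longrightarrow> ideal_depth R M = prime_height R M)"

text \<open>Used for prime ideals only, like \<^const>\<open>prime_height\<close>.\<close>

definition complete_intersection_prime :: "('a, 'b) ring_scheme \<Rightarrow> 'a set \<Rightarrow> bool" where
  "complete_intersection_prime R P \<longleftrightarrow>
     (\<exists>G. finite G \<and> G \<subseteq> carrier R \<and> genideal R G = P \<and> enat (card G) = prime_height R P)"

definition minimally_generates :: "('a, 'b) ring_scheme \<Rightarrow> 'a set \<Rightarrow> 'a set \<Rightarrow> bool" where
  "minimally_generates R G I \<longleftrightarrow>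
     G \<subseteq> carrier R \<and> genideal R G = I \<and> (\<forall>H. H \<subset> G \<longrightarrow> genideal R H \<noteq> I)"


section \<open>Polynomials in four variables\<close>

text \<open>
  The variables are indexed by the four-element type \<^typ>\<open>4\<close>, whose elements are
  \<open>1\<close>, \<open>2\<close>, \<open>3\<close>, \<open>4\<close>. Arithmetic there is modulo four, so that \<open>4 = 0\<close>; only the fact that
  these four indices are distinct and exhaust the type matters, and the order on \<^typ>\<open>4\<close> is
  never used.
\<close>

type_synonym 'k poly4 = "(4 \<Rightarrow>\<^sub>0 nat) \<Rightarrow>\<^sub>0 'k"

definition pvar :: "4 \<Rightarrow> 'k::comm_ring_1 poly4" where
  "pvar i = Poly_Mapping.single (Poly_Mapping.single i 1) 1"

definition poly_ring4 :: "'k::comm_ring_1 poly4 ring" where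
  "poly_ring4 = ring_of_type_algebra"

definition mon_deg :: "(4 \<Rightarrow>\<^sub>0 nat) \<Rightarrow> nat" where
  "mon_deg m = (\<Sum>i\<in>UNIV. Poly_Mapping.lookup m i)"

text \<open>The homogeneous summand of least degree; it is \<open>0\<close> for the zero polynomial.\<close>

definition least_form :: "'k::comm_ring_1 poly4 \<Rightarrow> 'k poly4" where
  "least_form f =
     (\<Sum>m\<in>{m\<in>Poly_Mapping.keys f. mon_deg m = Min (mon_deg ` Poly_Mapping.keys f)}.
        Poly_Mapping.single m (Poly_Mapping.lookup f m))"

definition initial_ideal :: "'k::comm_ring_1 poly4 set \<Rightarrow> 'k poly4 set" where
  "initial_ideal I = genideal poly_ring4 (least_form ` I)"


section \<open>Monomial curves in affine four-space\<close>

definition curve_hom :: "(4 \<Rightarrow> nat) \<Rightarrow> 'k::field poly4 \<Rightarrow> 'k poly" where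
  "curve_hom n f =
     (\<Sum>m\<in>Poly_Mapping.keys f.
        Polynomial.smult (Poly_Mapping.lookup f m)
          (\<Prod>i\<in>UNIV. Polynomial.monom 1 (n i) ^ Poly_Mapping.lookup m i))"

definition curve_ideal :: "(4 \<Rightarrow> nat) \<Rightarrow> 'k::field poly4 set" where
  "curve_ideal n = {f. curve_hom n f = 0}"

definition curve_semigroup :: "(4 \<Rightarrow> nat) \<Rightarrow> nat set" where
  "curve_semigroup n = {s. \<exists>g :: 4 \<Rightarrow> nat. s = (\<Sum>i\<in>UNIV. g i * n i)}"

text \<open>
  \<open>F\<close> is the Frobenius number, the largest integer outside \<open>S\<close> (it is \<open>-1\<close> for the
  semigroup of all non-negative integers).
\<close>

definition symmetric_semigroup :: "nat set \<Rightarrow> bool" where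
  "symmetric_semigroup S \<longleftrightarrow>
     (\<exists>F::int. F \<notin> int ` S \<and> (\<forall>z>F. z \<in> int ` S) \<and>
        (\<forall>z. z \<in> int ` S \<longleftrightarrow> F - z \<notin> int ` S))"

definition Gorenstein_curve :: "(4 \<Rightarrow> nat) \<Rightarrow> bool" where
  "Gorenstein_curve n \<longleftrightarrow> symmetric_semigroup (curve_semigroup n)"

text \<open>
  The last two notions depend on the field \<open>K\<close>, which is passed through the type of the
  ideal \<open>I(C)\<close>.
\<close>

definition complete_intersection_curve :: "'k::field poly4 set \<Rightarrow> bool" where
  "complete_intersection_curve I \<longleftrightarrow> complete_intersection_prime poly_ring4 I"

definition CM_tangent_cone :: "'k::field poly4 set \<Rightarrow> bool" where
  "CM_tangent_cone I \<longleftrightarrow> Cohen_Macaulay (poly_ring4 Quot (initial_ideal I))"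

end

theory Submission
  imports Defs
begin

text \<open>
  The coordinate ring of the tangent cone is the associated graded ring of the semigroup ring. It has
  a basis \<open>e\<^sub>s\<close> indexed by the elements \<open>s\<close> of the semigroup: a monomial of weight \<open>s\<close> maps to
  \<open>e\<^sub>s\<close> if it is a longest factorization of \<open>s\<close>, and to \<open>0\<close> otherwise
  (\<open>initial_ideal_curve_ideal\<close>). As \<open>n 1\<close> is the smallest weight, the powers of \<open>x\<^sub>1\<close> are the only
  longest factorizations of their weights, so the other three variables are nilpotent and the cone
  is, as a set, a line with coordinate \<open>x\<^sub>1\<close>.

  For such a ring all maximal ideals have height one and depth at most one. It is Cohen--Macaulay
  if and only if \<open>x\<^sub>1\<close> is a nonzerodivisor (\<open>CM_tangent_cone_iff\<close>): a nonzerodivisor in the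
  maximal ideal of the origin is a multiple of \<open>x\<^sub>1\<close> up to nilpotents, which forces \<open>x\<^sub>1\<close> to be
  regular; and if \<open>x\<^sub>1\<close> is regular, then leading terms show that all nonzero polynomials in \<open>x\<^sub>1\<close>
  are, and that the ring is Noetherian.

  In terms of the basis, \<open>x\<^sub>1\<close> is regular if and only if multiplication by it preserves longest
  factorizations. An obstruction is a monomial without \<open>x\<^sub>1\<close> that is longer than all monomials
  of its weight that contain \<open>x\<^sub>1\<close> (\<open>length_regular_criterion\<close>). Since the five binomials generate
  the ideal of the curve, they connect all monomials of equal weight (\<open>moves_connect\<close>), and it is
  possible to follow these connections. The monomials that avoid \<open>x\<^sub>1\<close> but share their weight with a
  multiple of it form the ideal generated by
  \<open>x\<^sub>2\<^bsup>a12\<^esup>x\<^sub>3\<^bsup>a13\<^esup>\<close>, \<open>x\<^sub>4\<^bsup>a4\<^esup>\<close>, \<open>x\<^sub>3\<^bsup>a13\<^esup>x\<^sub>4\<^bsup>a24\<^esup>\<close>, \<open>x\<^sub>2\<^bsup>a2\<^esup>\<close> and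
  \<open>x\<^sub>3\<^bsup>a3 + a13\<^esup>\<close>. For the first three, the increasing weights make the other side of a relation long
  enough. The last two have so few factorizations that the longest one containing \<open>x\<^sub>1\<close> can be read
  off, and comparing lengths gives the two conditions of the theorem.
\<close>

section \<open>Rings presented by a type-class ring\<close>

text \<open>
  Calculating in a quotient with representatives from the type class avoids carrier conditions in
  every step.
\<close>

locale presented_ring = cring R for R :: "('r, 's) ring_scheme" (structure) +
  fixes \<pi> :: "'a::comm_ring_1 \<Rightarrow> 'r"
  assumes closed [simp]: "\<pi> a \<in> carrier R"
    and surj: "x \<in> carrier R \<Longrightarrow> \<exists>a. x = \<pi> a"
    and pi_add: "\<pi> (a + b) = \<pi> a \<oplus> \<pi> b"
    and pi_mult: "\<pi> (a * b) = \<pi> a \<otimes> \<pi> b"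
    and pi_one: "\<pi> 1 = \<one>"
begin

lemma pi_zero: "\<pi> 0 = \<zero>"
  using pi_add[of 0 0] add.r_cancel_one[of "\<pi> 0" "\<pi> 0"] by simp

lemma pi_minus: "\<pi> (a - b) = \<pi> a \<ominus> \<pi> b"
proof -
  have "\<pi> a = \<pi> (a - b) \<oplus> \<pi> b"
    using pi_add[of "a - b" b] by simp
  then show ?thesis
    by (simp add: minus_eq a_assoc r_neg)
qed

lemma pi_eq_iff: "\<pi> a = \<pi> b \<longleftrightarrow> \<pi> (a - b) = \<zero>"
  by (simp add: pi_minus r_right_minus_eq)

lemma kernel_add: "\<pi> a = \<zero> \<Longrightarrow> \<pi> b = \<zero> \<Longrightarrow> \<pi> (a + b) = \<zero>"
  by (simp add: pi_add)

lemma kernel_mult: "\<pi> a = \<zero> \<Longrightarrow> \<pi> (b * a) = \<zero>"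
  by (simp add: pi_mult)

lemma carrier_eq: "carrier R = range \<pi>"
  using surj closed by (auto simp del: closed)

lemma ideal_zero_mem: "ideal P R \<Longrightarrow> \<pi> 0 \<in> P"
  by (simp add: pi_zero additive_subgroup.zero_closed ideal.axioms(1))

lemma ideal_add: "ideal P R \<Longrightarrow> \<pi> a \<in> P \<Longrightarrow> \<pi> b \<in> P \<Longrightarrow> \<pi> (a + b) \<in> P"
  by (simp add: pi_add additive_subgroup.a_closed ideal.axioms(1))

lemma ideal_mult: "ideal P R \<Longrightarrow> \<pi> a \<in> P \<Longrightarrow> \<pi> (b * a) \<in> P"
  by (simp add: pi_mult ideal.I_l_closed)

lemma ideal_minus: "ideal P R \<Longrightarrow> \<pi> a \<in> P \<Longrightarrow> \<pi> b \<in> P \<Longrightarrow> \<pi> (a - b) \<in> P"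
  using ideal_add[of P a "-1 * b"] ideal_mult[of P b "-1"] by simp

lemma ideal_proper: "ideal P R \<Longrightarrow> P \<noteq> carrier R \<longleftrightarrow> \<pi> 1 \<notin> P"
  by (metis ideal.one_imp_carrier pi_one one_closed)

lemma ideal_subset:
  assumes "ideal P R" "\<And>a. \<pi> a \<in> P \<Longrightarrow> \<pi> a \<in> Q"
  shows "P \<subseteq> Q"
proof
  fix x
  assume "x \<in> P"
  moreover from this obtain a where "x = \<pi> a"
    using surj additive_subgroup.a_Hcarr[OF ideal.axioms(1)[OF assms(1)]] by metis
  ultimately show "x \<in> Q"
    using assms(2) by simp
qed

lemma prime_mult:
  assumes "primeideal P R" "\<pi> (a * b) \<in> P"
  shows "\<pi> a \<in> P \<or> \<pi> b \<in> P"
  using primeideal.I_prime[OF assms(1), of "\<pi> a" "\<pi> b"] assms(2) by (simp add: pi_mult)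

lemma prime_power:
  assumes "primeideal P R" "\<pi> (a ^ N) \<in> P"
  shows "\<pi> a \<in> P"
  using assms(2)
proof (induction N)
  case 0
  then show ?case
    using assms(1) ideal_proper[OF primeideal.axioms(1)] primeideal.I_notcarr by auto
next
  case (Suc N)
  then show ?case
    using prime_mult[OF assms(1), of a "a ^ N"] by auto
qed

lemma ideal_image:
  assumes "0 \<in> Z" "\<And>a b. a \<in> Z \<Longrightarrow> b \<in> Z \<Longrightarrow> a + b \<in> Z" "\<And>a b. a \<in> Z \<Longrightarrow> b * a \<in> Z"
  shows "ideal (\<pi> ` Z) R"
proof (rule idealI)
  show "subgroup (\<pi> ` Z) (add_monoid R)"
  proof (rule group.subgroupI)
    show "Group.group (add_monoid R)"
      using a_group .
    fix x y
    assume x: "x \<in> \<pi> ` Z"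
    then obtain a where a: "a \<in> Z" "x = \<pi> a"
      by auto
    have "\<pi> (-1 * a) = \<ominus> \<pi> a"
      using pi_minus[of 0 a] by (simp add: pi_zero minus_eq)
    then have "\<ominus> x \<in> \<pi> ` Z"
      using a assms(3)[of a "-1"] by (metis imageI)
    then show "inv\<^bsub>add_monoid R\<^esub> x \<in> \<pi> ` Z"
      by (simp add: a_inv_def)
    assume "y \<in> \<pi> ` Z"
    then show "x \<otimes>\<^bsub>add_monoid R\<^esub> y \<in> \<pi> ` Z"
      using a assms(2) by (auto simp flip: pi_add)
  qed (use assms(1) in auto)
  show "x \<otimes> a \<in> \<pi> ` Z" "a \<otimes> x \<in> \<pi> ` Z" if ax: "a \<in> \<pi> ` Z" "x \<in> carrier R" for a x
  proof -
    obtain b e where be: "x = \<pi> b" "e \<in> Z" "a = \<pi> e"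
      using ax(1) surj[OF ax(2)] by auto
    have "\<pi> (b * e) \<in> \<pi> ` Z"
      using be assms(3) by blast
    then show "x \<otimes> a \<in> \<pi> ` Z" "a \<otimes> x \<in> \<pi> ` Z"
      unfolding be by (simp_all add: pi_mult m_comm)
  qed
qed (rule ring_axioms)

lemma genideal_empty: "Idl {} = {\<zero>}"
proof
  show "Idl {} \<subseteq> {\<zero>}"
    by (rule genideal_minimal[OF zeroideal]) simp
  have "ideal (Idl {}) R"
    by (rule genideal_ideal) simp
  then show "{\<zero>} \<subseteq> Idl {}"
    using ideal_zero_mem pi_zero by auto
qed

text \<open>
  By the binomial theorem: in each term either the exponent of \<open>a\<close> is at least \<open>N\<close> or that of \<open>b\<close>
  is at least \<open>L\<close>.
\<close>

lemma radical_add: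
  assumes P: "ideal P R" and a: "\<pi> (a ^ N) \<in> P" and b: "\<pi> (b ^ L) \<in> P"
  shows "\<pi> ((a + b) ^ (N + L)) \<in> P"
proof -
  have sum: "\<pi> (sum g A) \<in> P" if "finite A" "\<And>k. k \<in> A \<Longrightarrow> \<pi> (g k) \<in> P" for g :: "nat \<Rightarrow> 'a" and A
    using that by (induction A rule: finite_induct) (auto simp: ideal_zero_mem[OF P] ideal_add[OF P])
  have "\<pi> (of_nat (N + L choose k) * a ^ k * b ^ (N + L - k)) \<in> P" if "k \<le> N + L" for k
  proof (cases "N \<le> k")
    case True
    then have "a ^ k = a ^ (k - N) * a ^ N"
      by (simp flip: power_add)
    then have "of_nat (N + L choose k) * a ^ k * b ^ (N + L - k)
        = (of_nat (N + L choose k) * a ^ (k - N) * b ^ (N + L - k)) * a ^ N"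
      by (simp add: algebra_simps)
    then show ?thesis
      using ideal_mult[OF P a] by simp
  next
    case False
    then have "N + L - k = (N - k) + L"
      by simp
    then have "of_nat (N + L choose k) * a ^ k * b ^ (N + L - k)
        = (of_nat (N + L choose k) * a ^ k * b ^ (N - k)) * b ^ L"
      by (simp add: power_add algebra_simps)
    then show ?thesis
      using ideal_mult[OF P b] by simp
  qed
  then show ?thesis
    unfolding binomial_ring by (intro sum) auto
qed

end

lemma poly_ideal_generator:
  fixes Q :: "'k::field poly set"
  assumes "0 \<in> Q" "\<And>p q. p \<in> Q \<Longrightarrow> q \<in> Q \<Longrightarrow> p + q \<in> Q" "\<And>p q. p \<in> Q \<Longrightarrow> q * p \<in> Q"
  obtains q where "\<And>p. p \<in> Q \<longleftrightarrow> q dvd p"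
proof (cases "\<exists>p\<in>Q. p \<noteq> 0")
  case False
  then show ?thesis
    using assms(1) that[of 0] by auto
next
  case True
  define q where "q = arg_min Polynomial.degree (\<lambda>p. p \<in> Q \<and> p \<noteq> 0)"
  have q: "q \<in> Q" "q \<noteq> 0" and min: "\<And>p. p \<in> Q \<Longrightarrow> p \<noteq> 0 \<Longrightarrow> Polynomial.degree q \<le> Polynomial.degree p"
    using True arg_min_nat_lemma[of "\<lambda>p. p \<in> Q \<and> p \<noteq> 0" _ Polynomial.degree] unfolding q_def by blast+
  have "q dvd p" if "p \<in> Q" for p
  proof -
    have "p mod q \<in> Q"
      using assms(2)[OF that assms(3)[OF q(1), of "- (p div q)"]] by (simp add: minus_div_mult_eq_mod)
    then have "p mod q = 0"
      using min[of "p mod q"] degree_mod_less[OF q(2), of p] by fastforce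
    then show ?thesis
      by auto
  qed
  then show ?thesis
    using that[of q] assms(3)[OF q(1)] by (auto simp: dvd_def mult.commute)
qed

section \<open>Nilpotent thickenings of the affine line\<close>

text \<open>
  Here \<open>\<rho>\<close> is a retraction of the ring onto \<open>K[t]\<close> with a kernel of nilpotent elements and \<open>c\<close> its
  section, both written on representatives.
\<close>

locale thickened_line = presented_ring R \<pi> for R :: "('r, 's) ring_scheme" (structure) and \<pi> :: "'a::comm_ring_1 \<Rightarrow> 'r" +
  fixes \<rho> :: "'a \<Rightarrow> 'k::field poly" and c :: "'k poly \<Rightarrow> 'a"
  assumes \<rho>_add: "\<rho> (a + b) = \<rho> a + \<rho> b" and \<rho>_mult: "\<rho> (a * b) = \<rho> a * \<rho> b"
    and \<rho>_kernel: "\<pi> a = \<zero> \<Longrightarrow> \<rho> a = 0"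
    and c_add: "c (p + q) = c p + c q" and c_mult: "c (p * q) = c p * c q" and c_one: "c 1 = 1"
    and \<rho>_c: "\<rho> (c p) = p"
    and nilpotent: "\<rho> a = 0 \<Longrightarrow> \<exists>N. \<pi> (a ^ N) = \<zero>"
begin

lemma \<rho>_one: "\<rho> 1 = 1"
  using \<rho>_c[of 1] by (simp add: c_one)

lemma \<rho>_zero: "\<rho> 0 = 0"
  using \<rho>_kernel[of 0] pi_zero by simp

lemma c_zero: "c 0 = 0"
  using c_add[of 0 0] by simp

lemma \<rho>_diff: "\<rho> (a - b) = \<rho> a - \<rho> b"
  using \<rho>_add[of "a - b" b] by simp

text \<open>A prime ideal contains the nilpotent element \<open>a - c (\<rho> a)\<close>.\<close>

lemma prime_retract:
  assumes "primeideal P R"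
  shows "\<pi> a \<in> P \<longleftrightarrow> \<pi> (c (\<rho> a)) \<in> P"
proof -
  have P: "ideal P R"
    using assms primeideal.axioms(1) by blast
  have "\<rho> (a - c (\<rho> a)) = 0"
    by (simp add: \<rho>_diff \<rho>_c)
  then obtain N where "\<pi> ((a - c (\<rho> a)) ^ N) = \<zero>"
    using nilpotent by blast
  then have d: "\<pi> (a - c (\<rho> a)) \<in> P"
    using prime_power[OF assms] ideal_zero_mem[OF P] pi_zero by metis
  show ?thesis
    using ideal_add[OF P _ d, of "c (\<rho> a)"] ideal_minus[OF P _ d, of a] by auto
qed

lemma prime_generator:
  assumes "primeideal P R"
  obtains q where "\<And>a. \<pi> a \<in> P \<longleftrightarrow> q dvd \<rho> a"
proof -
  have P: "ideal P R"
    using assms primeideal.axioms(1) by blast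
  obtain q where "\<And>p. p \<in> {p. \<pi> (c p) \<in> P} \<longleftrightarrow> q dvd p"
    by (rule poly_ideal_generator[of "{p. \<pi> (c p) \<in> P}"])
      (auto simp: c_zero c_add c_mult ideal_zero_mem[OF P] ideal_add[OF P] ideal_mult[OF P])
  then show ?thesis
    using that prime_retract[OF assms] by auto
qed

lemma prime_generator_not_unit:
  assumes "primeideal P R" "\<And>a. \<pi> a \<in> P \<longleftrightarrow> q dvd \<rho> a"
  shows "\<not> q dvd 1"
  using assms(2)[of 1] primeideal.I_notcarr[OF assms(1)] ideal_proper[OF primeideal.axioms(1)[OF assms(1)]]
  by (auto simp: \<rho>_one)

text \<open>
  Both primes come from ideals of the principal ideal domain \<open>K[t]\<close>. If \<open>p\<close> and \<open>q\<close> generate them,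
  then \<open>q\<close> divides \<open>p\<close>, and for \<open>p \<noteq> 0\<close> primality makes \<open>p\<close> and \<open>q\<close> associated.
\<close>

lemma smaller_prime:
  assumes P: "primeideal P R" and Q: "primeideal Q R" and sub: "P \<subset> Q"
  shows "\<pi> a \<in> P \<longleftrightarrow> \<rho> a = 0"
proof -
  obtain p where p: "\<And>a. \<pi> a \<in> P \<longleftrightarrow> p dvd \<rho> a"
    using prime_generator[OF P] by blast
  obtain q where q: "\<And>a. \<pi> a \<in> Q \<longleftrightarrow> q dvd \<rho> a"
    using prime_generator[OF Q] by blast
  have "p = 0"
  proof (rule ccontr)
    assume nz: "p \<noteq> 0"
    have "\<pi> (c p) \<in> Q"
      using p[of "c p"] sub by (auto simp: \<rho>_c)
    then obtain r where r: "p = q * r"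
      using q[of "c p"] by (auto simp: \<rho>_c)
    have "\<pi> (c p) \<in> P"
      using p[of "c p"] by (simp add: \<rho>_c)
    then have "\<pi> (c q * c r) \<in> P"
      by (simp add: r c_mult)
    then consider "p dvd q" | "p dvd r"
      using prime_mult[OF P] p by (metis \<rho>_c)
    then show False
    proof cases
      case 1
      then have "Q \<subseteq> P"
        using p q by (intro ideal_subset[OF primeideal.axioms(1)[OF Q]]) (auto intro: dvd_trans)
      then show ?thesis
        using sub by blast
    next
      case 2
      then have "p dvd 1"
        using r nz prime_generator_not_unit[OF Q q]
        by (metis dvd_mult_cancel_right dvd_times_right_cancel_iff mult.commute mult_1 mult_eq_0_iff)
      then show ?thesis
        using prime_generator_not_unit[OF P p] by blast
    qed
  qed
  then show ?thesis
    using p by simp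
qed

text \<open>For \<open>d = 0\<close> this is the nilradical, for \<open>d = t\<close> the maximal ideal of the origin.\<close>

lemma line_ideal: "ideal (\<pi> ` {a. d dvd \<rho> a}) R"
  by (rule ideal_image) (auto simp: \<rho>_zero \<rho>_add \<rho>_mult)

lemma line_ideal_mem: "\<pi> a \<in> \<pi> ` {a. d dvd \<rho> a} \<longleftrightarrow> d dvd \<rho> a"
proof -
  have "d dvd \<rho> a" if "\<pi> a = \<pi> b" "d dvd \<rho> b" for b
    using \<rho>_kernel[of "a - b"] that pi_eq_iff[of a b] by (simp add: \<rho>_diff)
  then show ?thesis
    by auto
qed

lemma nilradical_prime: "primeideal (\<pi> ` {a. 0 dvd \<rho> a}) R"
proof (rule primeidealI[OF line_ideal])
  show "carrier R \<noteq> \<pi> ` {a. 0 dvd \<rho> a}"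
    using line_ideal_mem[of 1 0] closed[of 1] by (metis \<rho>_one dvd_0_left_iff zero_neq_one)
  show "x \<in> \<pi> ` {a. 0 dvd \<rho> a} \<or> y \<in> \<pi> ` {a. 0 dvd \<rho> a}"
    if xy: "x \<in> carrier R" "y \<in> carrier R" "x \<otimes> y \<in> \<pi> ` {a. 0 dvd \<rho> a}" for x y
  proof -
    obtain a b where ab: "x = \<pi> a" "y = \<pi> b"
      using surj[OF xy(1)] surj[OF xy(2)] by auto
    have "0 dvd \<rho> (a * b)"
      using xy(3) line_ideal_mem[of "a * b" 0] unfolding ab pi_mult by blast
    then show ?thesis
      unfolding ab line_ideal_mem by (simp add: \<rho>_mult)
  qed
qed (rule is_cring)

lemma origin_maximal: "maximalideal (\<pi> ` {a. [:0, 1:] dvd \<rho> a}) R"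
proof (rule maximalidealI[OF line_ideal])
  have dvd_iff: "[:0, 1:] dvd p \<longleftrightarrow> Polynomial.coeff p 0 = 0" for p :: "'k poly"
    using dvd_iff_poly_eq_0[of 0 p] by (simp add: poly_0_coeff_0)
  show "carrier R \<noteq> \<pi> ` {a. [:0, 1:] dvd \<rho> a}"
  proof -
    have "\<not> [:0, 1:] dvd \<rho> 1"
      unfolding dvd_iff \<rho>_one by simp
    then show ?thesis
      using line_ideal_mem[of 1 "[:0, 1:]"] closed[of 1] by metis
  qed
  fix N
  assume N: "ideal N R" and sub: "\<pi> ` {a. [:0, 1:] dvd \<rho> a} \<subseteq> N" "N \<subseteq> carrier R"
  show "N = \<pi> ` {a. [:0, 1:] dvd \<rho> a} \<or> N = carrier R"
  proof (rule disjCI)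
    assume "N \<noteq> carrier R"
    then have 1: "\<pi> 1 \<notin> N"
      using ideal_proper[OF N] by blast
    have "N \<subseteq> \<pi> ` {a. [:0, 1:] dvd \<rho> a}"
    proof (rule ideal_subset[OF N], rule ccontr)
      fix a
      assume a: "\<pi> a \<in> N" "\<pi> a \<notin> \<pi> ` {a. [:0, 1:] dvd \<rho> a}"
      then have nz: "Polynomial.coeff (\<rho> a) 0 \<noteq> 0"
        using line_ideal_mem[of a "[:0, 1:]"] dvd_iff[of "\<rho> a"] by blast
      define b where "b = c [:inverse (Polynomial.coeff (\<rho> a) 0):] * a"
      have "[:0, 1:] dvd \<rho> (1 - b)"
        using nz unfolding dvd_iff by (simp add: b_def \<rho>_diff \<rho>_mult \<rho>_c \<rho>_one)
      then have "\<pi> (1 - b) \<in> N"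
        using sub(1) by blast
      moreover have "\<pi> b \<in> N"
        unfolding b_def by (rule ideal_mult[OF N a(1)])
      ultimately have "\<pi> (1 - b + b) \<in> N"
        by (rule ideal_add[OF N])
      then show False
        using 1 by simp
    qed
    then show "N = \<pi> ` {a. [:0, 1:] dvd \<rho> a}"
      using sub(1) by blast
  qed
qed

text \<open>
  The primes are the nilradical and, above it, the ones that come from closed points of the line; a
  maximal ideal differs from the nilradical because \<open>K[t]\<close> is not a field.
\<close>

lemma height_maximal:
  assumes M: "maximalideal M R"
  shows "prime_height R M = 1"
proof -
  have M': "primeideal M R"
    using maximalideal_prime[OF M] .
  define N where "N = \<pi> ` {a. 0 dvd \<rho> a}"
  have N: "primeideal N R"
    unfolding N_def by (rule nilradical_prime)
  have "N \<subseteq> M"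
  proof (rule ideal_subset[OF primeideal.axioms(1)[OF N]])
    fix a
    assume "\<pi> a \<in> N"
    then have "\<rho> a = 0"
      using line_ideal_mem[of a 0] by (simp add: N_def)
    then show "\<pi> a \<in> M"
      using prime_retract[OF M', of a] ideal_zero_mem[OF primeideal.axioms(1)[OF M']] by (simp add: c_zero)
  qed
  moreover have "N \<noteq> M"
  proof
    assume "N = M"
    then have max: "maximalideal N R"
      using M by simp
    define Q where "Q = \<pi> ` {a. [:0, 1:] dvd \<rho> a}"
    have Q: "maximalideal Q R"
      unfolding Q_def by (rule origin_maximal)
    have "N \<subseteq> Q"
      unfolding N_def Q_def by auto
    moreover have "\<pi> (c [:0, 1:]) \<in> Q" "\<pi> (c [:0, 1:]) \<notin> N"
      unfolding N_def Q_def line_ideal_mem by (simp_all add: \<rho>_c)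
    moreover have "Q \<noteq> carrier R" "ideal Q R" "Q \<subseteq> carrier R"
      using maximalideal.I_notcarr[OF Q] line_ideal carrier_eq unfolding Q_def by auto
    ultimately show False
      using maximalideal.I_maximal[OF max, of Q] by blast
  qed
  ultimately have chain: "N \<subset> M"
    by blast
  define H where "H = {n. \<exists>c :: nat \<Rightarrow> 'r set.
                (\<forall>i\<le>n. primeideal (c i) R) \<and> (\<forall>i<n. c i \<subset> c (Suc i)) \<and> c n = M}"
  have "1 \<in> H"
    unfolding H_def using chain N M' by (intro CollectI exI[of _ "\<lambda>i. if i = 0 then N else M"]) auto
  moreover have "n \<le> 1" if nH: "n \<in> H" for n
  proof (rule ccontr)
    assume "\<not> n \<le> 1"
    then obtain k where k: "n = Suc (Suc k)"
      by (metis One_nat_def Suc_le_mono le0 not0_implies_Suc)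
    obtain C where C: "\<And>i. i \<le> n \<Longrightarrow> primeideal (C i) R" "\<And>i. i < n \<Longrightarrow> C i \<subset> C (Suc i)"
      using nH unfolding H_def by blast
    have "\<And>a. \<pi> a \<in> C k \<longleftrightarrow> \<rho> a = 0" "\<And>a. \<pi> a \<in> C (Suc k) \<longleftrightarrow> \<rho> a = 0"
      using smaller_prime[of "C k" "C (Suc k)"] smaller_prime[of "C (Suc k)" "C (Suc (Suc k))"] C k by simp_all
    then have "C (Suc k) \<subseteq> C k"
      using C(1)[of "Suc k"] k by (intro ideal_subset) (auto simp: primeideal.axioms(1))
    then show False
      using C(2)[of k] k by auto
  qed
  ultimately have "(SUP n\<in>H. enat n) = 1"
    by (intro cSup_eq_maximum) (auto simp: one_enat_def)
  then show ?thesis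
    unfolding prime_height_def H_def .
qed

text \<open>
  If \<open>f\<close> is a nonzerodivisor, then the ring modulo \<open>f\<close> is zero-dimensional, so that every element
  of a maximal ideal containing \<open>f\<close> divides zero modulo \<open>f\<close>. Concretely, among the polynomials \<open>r\<close> that lie in the
  radical of \<open>(f)\<close> a generator of the maximal ideal can be cancelled by means of \<open>g\<close>, and each
  cancellation lowers the degree.
\<close>

lemma no_regular_pair:
  assumes M: "maximalideal M R" and fM: "\<pi> f \<in> M" and gM: "\<pi> g \<in> M"
    and f_reg: "\<And>z. \<pi> (f * z) = \<zero> \<Longrightarrow> \<pi> z = \<zero>"
    and g_reg: "\<And>z. \<pi> (g * z) \<in> Idl {\<pi> f} \<Longrightarrow> \<pi> z \<in> Idl {\<pi> f}"
  shows False
proof -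
  have M': "primeideal M R"
    using maximalideal_prime[OF M] .
  have iM: "ideal M R"
    using M' primeideal.axioms(1) by blast
  define A where "A = Idl {\<pi> f}"
  have A: "ideal A R"
    unfolding A_def by (rule genideal_ideal) simp
  have AM: "A \<subseteq> M"
    unfolding A_def by (rule genideal_minimal[OF iM]) (use fM in simp)
  have fA: "\<pi> f \<in> A"
    unfolding A_def using genideal_self'[of "\<pi> f"] by simp
  obtain q where q: "\<And>a. \<pi> a \<in> M \<longleftrightarrow> q dvd \<rho> a"
    using prime_generator[OF M'] by blast
  have q_unit: "\<not> q dvd 1"
    using prime_generator_not_unit[OF M' q] .
  define D where "D = {r. r \<noteq> 0 \<and> (\<exists>N. \<pi> (c r ^ N) \<in> A)}"
  have f_nil: "\<rho> f \<noteq> 0"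
  proof
    assume "\<rho> f = 0"
    then obtain N where N: "\<pi> (f ^ N) = \<zero>"
      using nilpotent by blast
    have "\<pi> 1 = \<zero>" if "\<pi> (f ^ N) = \<zero>" for N
      using that by (induction N) (use f_reg in auto)
    then show False
      using N ideal_zero_mem[OF iM] primeideal.I_notcarr[OF M'] ideal_proper[OF iM] pi_zero by metis
  qed
  have "\<rho> f \<in> D"
  proof -
    have "\<rho> (c (\<rho> f) - f) = 0"
      by (simp add: \<rho>_diff \<rho>_c)
    then obtain N where "\<pi> ((c (\<rho> f) - f) ^ N) = \<zero>"
      using nilpotent by blast
    then have "\<pi> ((f + (c (\<rho> f) - f)) ^ (1 + N)) \<in> A"
      using fA ideal_zero_mem[OF A] pi_zero by (intro radical_add[OF A]) simp_all
    then have "\<exists>N. \<pi> (c (\<rho> f) ^ N) \<in> A"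
      by (intro exI[of _ "1 + N"]) simp
    then show ?thesis
      using f_nil by (simp add: D_def)
  qed
  moreover have "\<exists>s\<in>D. Polynomial.degree s < Polynomial.degree r" if rD: "r \<in> D" for r
  proof -
    obtain N where r: "r \<noteq> 0" "\<pi> (c r ^ N) \<in> A"
      using rD by (auto simp: D_def)
    then have "\<pi> (c r) \<in> M"
      using AM prime_power[OF M'] by blast
    then obtain s where s: "r = q * s"
      using q[of "c r"] by (auto simp: \<rho>_c)
    obtain h where h: "\<rho> g = q * h"
      using q[of g] gM by auto
    have "\<rho> (g - c (\<rho> g)) = 0"
      by (simp add: \<rho>_diff \<rho>_c)
    then obtain L where "\<pi> ((g - c (\<rho> g)) ^ L) = \<zero>"
      using nilpotent by blast
    then have "\<pi> (c s ^ L * (g - c (\<rho> g)) ^ L) = \<zero>"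
      by (rule kernel_mult)
    then have "\<pi> ((c s * (g - c (\<rho> g))) ^ L) \<in> A"
      using ideal_zero_mem[OF A] by (simp add: power_mult_distrib pi_zero)
    moreover have "\<pi> ((c h * c r) ^ N) \<in> A"
      unfolding power_mult_distrib by (rule ideal_mult[OF A r(2)])
    ultimately have "\<pi> ((c h * c r + c s * (g - c (\<rho> g))) ^ (N + L)) \<in> A"
      using radical_add[OF A] by blast
    moreover have "c h * c r + c s * (g - c (\<rho> g)) = g * c s"
      unfolding h s c_mult by (simp add: algebra_simps)
    ultimately have gs: "\<pi> (g ^ (N + L) * c s ^ (N + L)) \<in> A"
      by (simp add: power_mult_distrib)
    have cancel: "\<pi> z \<in> A" if "\<pi> (g ^ k * z) \<in> A" for k z
      using that
    proof (induction k)
      case (Suc k)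
      have "\<pi> (g * (g ^ k * z)) \<in> A"
        using Suc.prems by (simp add: mult.assoc)
      then show ?case
        using g_reg Suc.IH unfolding A_def by blast
    qed simp
    have "s \<in> D"
      using cancel[OF gs] r(1) s by (auto simp: D_def)
    moreover have "Polynomial.degree s < Polynomial.degree r"
    proof -
      have "q \<noteq> 0" "s \<noteq> 0"
        using r s by auto
      moreover from this have "Polynomial.degree q \<noteq> 0"
        using q_unit by (simp add: is_unit_iff_degree)
      ultimately show ?thesis
        unfolding s by (simp add: degree_mult_eq)
    qed
    ultimately show ?thesis
      by blast
  qed
  ultimately show False
    using infinite_descent_measure[of "\<lambda>r. r \<notin> D" Polynomial.degree "\<rho> f"] by blast
qed

lemma depth_maximal:
  assumes M: "maximalideal M R"
  shows "ideal_depth R M = 1 \<longleftrightarrow> (\<exists>f. \<pi> f \<in> M \<and> (\<forall>z. \<pi> (f * z) = \<zero> \<longrightarrow> \<pi> z = \<zero>))"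
    (is "_ \<longleftrightarrow> ?regular")
proof -
  have iM: "ideal M R"
    using maximalideal_prime[OF M] primeideal.axioms(1) by blast
  have M1: "M \<noteq> carrier R"
    using maximalideal.I_notcarr[OF M] by auto
  define Z where "Z = {xs. regular_sequence R xs \<and> set xs \<subseteq> M}"
  have entry: "y \<in> Idl (set (take i xs))"
    if "regular_sequence R xs" "i < length xs" "y \<in> carrier R" "xs ! i \<otimes> y \<in> Idl (set (take i xs))"
    for xs i y
    using that unfolding regular_sequence_def by blast
  have first: "\<pi> z = \<zero>" if "regular_sequence R (\<pi> f # xs)" "\<pi> (f * z) = \<zero>" for f xs z
    using entry[OF that(1), of 0 "\<pi> z"] that(2) by (simp add: genideal_empty pi_mult)
  have le1: "length xs \<le> 1" if xs: "xs \<in> Z" for xs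
  proof (rule ccontr)
    assume "\<not> length xs \<le> 1"
    then obtain x y ys where xs': "xs = x # y # ys"
      by (cases xs; cases "tl xs") auto
    have xy: "x \<in> carrier R" "y \<in> carrier R"
      using xs unfolding Z_def xs' regular_sequence_def by simp_all
    obtain f g where fg: "x = \<pi> f" "y = \<pi> g"
      using surj[OF xy(1)] surj[OF xy(2)] by auto
    have reg: "regular_sequence R (\<pi> f # \<pi> g # ys)"
      using xs unfolding Z_def xs' fg by simp
    show False
    proof (rule no_regular_pair[OF M])
      show "\<pi> f \<in> M" "\<pi> g \<in> M"
        using xs unfolding Z_def xs' fg by simp_all
      show "\<pi> z = \<zero>" if "\<pi> (f * z) = \<zero>" for z
        using first[OF reg that] .
      show "\<pi> z \<in> Idl {\<pi> f}" if "\<pi> (g * z) \<in> Idl {\<pi> f}" for z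
        using entry[OF reg, of 1 "\<pi> z"] that by (simp add: pi_mult)
    qed
  qed
  have "ideal_depth R M = (SUP xs\<in>Z. enat (length xs))"
    unfolding ideal_depth_def Z_def ..
  also have "\<dots> = 1 \<longleftrightarrow> (\<exists>xs\<in>Z. length xs = 1)"
  proof
    assume "(SUP xs\<in>Z. enat (length xs)) = 1"
    then have "\<not> (SUP xs\<in>Z. enat (length xs)) \<le> 0"
      by simp
    then have "\<not> (\<forall>xs\<in>Z. enat (length xs) \<le> 0)"
      by (meson SUP_least)
    then obtain xs where "xs \<in> Z" "length xs \<noteq> 0"
      by (auto simp: zero_enat_def)
    then show "\<exists>xs\<in>Z. length xs = 1"
      using le1[of xs] by (intro bexI[of _ xs]) linarith+
  next
    assume "\<exists>xs\<in>Z. length xs = 1"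
    then obtain xs where xs: "xs \<in> Z" "length xs = 1"
      by blast
    show "(SUP xs\<in>Z. enat (length xs)) = 1"
    proof (rule antisym)
      show "(SUP xs\<in>Z. enat (length xs)) \<le> 1"
        by (rule SUP_least) (use le1 in \<open>simp add: one_enat_def\<close>)
      show "1 \<le> (SUP xs\<in>Z. enat (length xs))"
        by (rule SUP_upper2[OF xs(1)]) (use xs(2) in \<open>simp add: one_enat_def\<close>)
    qed
  qed
  also have "\<dots> \<longleftrightarrow> ?regular"
  proof
    assume "\<exists>xs\<in>Z. length xs = 1"
    then obtain x where x: "[x] \<in> Z"
      by (auto simp: length_Suc_conv)
    then have "x \<in> carrier R"
      unfolding Z_def regular_sequence_def by simp
    from surj[OF this] obtain f where "x = \<pi> f"
      by auto
    then show ?regular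
      using x first[of f "[]"] unfolding Z_def by (intro exI[of _ f]) simp
  next
    assume ?regular
    then obtain f where f: "\<pi> f \<in> M" "\<And>z. \<pi> (f * z) = \<zero> \<Longrightarrow> \<pi> z = \<zero>"
      by blast
    have "Idl {\<pi> f} \<subseteq> M"
      by (rule genideal_minimal[OF iM]) (use f in simp)
    moreover have "M \<subseteq> carrier R"
      using additive_subgroup.a_subset[OF ideal.axioms(1)[OF iM]] .
    ultimately have "Idl {\<pi> f} \<noteq> carrier R"
      using M1 by blast
    moreover have "y = \<zero>" if y: "y \<in> carrier R" "\<pi> f \<otimes> y = \<zero>" for y
    proof -
      obtain z where "y = \<pi> z"
        using surj[OF y(1)] by auto
      then show ?thesis
        using y(2) f(2)[of z] by (simp add: pi_mult)
    qed
    ultimately have "[\<pi> f] \<in> Z"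
      unfolding Z_def regular_sequence_def using f(1) by (simp add: genideal_empty)
    then show "\<exists>xs\<in>Z. length xs = 1"
      by (intro bexI[of _ "[\<pi> f]"]) simp_all
  qed
  finally show ?thesis .
qed

text \<open>
  An element of the maximal ideal of the origin is a multiple of \<open>t\<close> plus a nilpotent, so it acts
  nilpotently on the annihilator of \<open>t\<close>; if it is a nonzerodivisor, that annihilator is zero. For
  the converse, each maximal ideal contains a nonzero polynomial in \<open>t\<close>. The two hypotheses are
  where the particular ring enters: what regularity of \<open>t\<close> has to imply for the ring to be
  Noetherian and for those polynomials to be regular.
\<close>

theorem Cohen_Macaulay_iff:
  assumes noeth: "(\<And>z. \<pi> (c [:0, 1:] * z) = \<zero> \<Longrightarrow> \<pi> z = \<zero>) \<Longrightarrow> noetherian_ring R"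
    and reg: "\<And>p z. (\<And>z. \<pi> (c [:0, 1:] * z) = \<zero> \<Longrightarrow> \<pi> z = \<zero>) \<Longrightarrow> p \<noteq> 0 \<Longrightarrow> \<pi> (c p * z) = \<zero> \<Longrightarrow> \<pi> z = \<zero>"
  shows "Cohen_Macaulay R \<longleftrightarrow> (\<forall>z. \<pi> (c [:0, 1:] * z) = \<zero> \<longrightarrow> \<pi> z = \<zero>)"
proof
  assume CM: "Cohen_Macaulay R"
  define M where "M = \<pi> ` {a. [:0, 1:] dvd \<rho> a}"
  have M: "maximalideal M R"
    unfolding M_def by (rule origin_maximal)
  have "ideal_depth R M = 1"
    using CM M height_maximal unfolding Cohen_Macaulay_def by auto
  then obtain f where f: "\<pi> f \<in> M" "\<And>z. \<pi> (f * z) = \<zero> \<Longrightarrow> \<pi> z = \<zero>"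
    using depth_maximal[OF M] by blast
  obtain h where h: "\<rho> f = [:0, 1:] * h"
    using f(1) unfolding M_def line_ideal_mem by blast
  define \<nu> where "\<nu> = f - c (\<rho> f)"
  have "\<rho> \<nu> = 0"
    by (simp add: \<nu>_def \<rho>_diff \<rho>_c)
  then obtain N where N: "\<pi> (\<nu> ^ N) = \<zero>"
    using nilpotent by blast
  show "\<forall>z. \<pi> (c [:0, 1:] * z) = \<zero> \<longrightarrow> \<pi> z = \<zero>"
  proof (intro allI impI)
    fix z
    assume z: "\<pi> (c [:0, 1:] * z) = \<zero>"
    have "\<pi> (\<nu> ^ k * z) = \<zero> \<Longrightarrow> \<pi> z = \<zero>" for k
    proof (induction k)
      case (Suc k)
      have "f * (\<nu> ^ k * z) = \<nu> ^ Suc k * z + (\<nu> ^ k * c h) * (c [:0, 1:] * z)"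
        unfolding \<nu>_def h c_mult by (simp add: algebra_simps)
      then have "\<pi> (f * (\<nu> ^ k * z)) = \<zero>"
        using Suc.prems kernel_mult[OF z] kernel_add by metis
      then show ?case
        using f(2) Suc.IH by blast
    qed simp
    moreover have "\<pi> (\<nu> ^ N * z) = \<zero>"
      using kernel_mult[OF N, of z] by (simp add: mult.commute)
    ultimately show "\<pi> z = \<zero>"
      by blast
  qed
next
  assume *: "\<forall>z. \<pi> (c [:0, 1:] * z) = \<zero> \<longrightarrow> \<pi> z = \<zero>"
  have "ideal_depth R M = prime_height R M" if M: "maximalideal M R" for M
  proof -
    have M': "primeideal M R"
      using maximalideal_prime[OF M] .
    obtain q where q: "\<And>a. \<pi> a \<in> M \<longleftrightarrow> q dvd \<rho> a"
      using prime_generator[OF M'] by blast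
    have "q \<noteq> 0"
    proof
      assume "q = 0"
      define Q where "Q = \<pi> ` {a. [:0, 1:] dvd \<rho> a}"
      have Q: "maximalideal Q R"
        unfolding Q_def by (rule origin_maximal)
      have "M \<subseteq> Q"
        using q \<open>q = 0\<close> unfolding Q_def
        by (intro ideal_subset[OF primeideal.axioms(1)[OF M']]) (auto simp: line_ideal_mem)
      moreover have "\<pi> (c [:0, 1:]) \<in> Q" "\<pi> (c [:0, 1:]) \<notin> M"
        unfolding Q_def line_ideal_mem q \<open>q = 0\<close> by (simp_all add: \<rho>_c)
      moreover have "Q \<noteq> carrier R" "ideal Q R" "Q \<subseteq> carrier R"
        using maximalideal.I_notcarr[OF Q] line_ideal carrier_eq unfolding Q_def by auto
      ultimately show False
        using maximalideal.I_maximal[OF M, of Q] by blast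
    qed
    moreover have "\<pi> (c q) \<in> M"
      by (simp add: q \<rho>_c)
    ultimately have "ideal_depth R M = 1"
      unfolding depth_maximal[OF M] using reg * by blast
    then show ?thesis
      by (simp add: height_maximal[OF M])
  qed
  then show "Cohen_Macaulay R"
    unfolding Cohen_Macaulay_def using noeth * is_cring by blast
qed

end

section \<open>Polynomials as finitely supported functions\<close>

definition coeff_sum :: "'m set \<Rightarrow> ('m \<Rightarrow>\<^sub>0 'k::comm_monoid_add) \<Rightarrow> 'k" where
  "coeff_sum A f = (\<Sum>m\<in>Poly_Mapping.keys f \<inter> A. Poly_Mapping.lookup f m)"

lemma coeff_sum_superset:
  assumes "finite F" "Poly_Mapping.keys f \<subseteq> F"
  shows "coeff_sum A f = (\<Sum>m\<in>F \<inter> A. Poly_Mapping.lookup f m)"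
  unfolding coeff_sum_def using assms by (intro sum.mono_neutral_left) (auto simp: in_keys_iff)

lemma coeff_sum_cong:
  assumes "Poly_Mapping.keys f \<inter> A = Poly_Mapping.keys f \<inter> B"
  shows "coeff_sum A f = coeff_sum B f"
  unfolding coeff_sum_def using assms by simp

lemma coeff_sum_zero [simp]: "coeff_sum A 0 = 0"
  by (simp add: coeff_sum_def)

lemma coeff_sum_empty [simp]: "coeff_sum {} f = 0"
  by (simp add: coeff_sum_def)

lemma coeff_sum_add: "coeff_sum A (f + g) = coeff_sum A f + coeff_sum A g"
proof -
  define F where "F = Poly_Mapping.keys f \<union> Poly_Mapping.keys g"
  have "finite F" "Poly_Mapping.keys (f + g) \<subseteq> F" "Poly_Mapping.keys f \<subseteq> F" "Poly_Mapping.keys g \<subseteq> F"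
    using Poly_Mapping.keys_add[of f g] by (auto simp: F_def)
  then show ?thesis
    by (simp add: coeff_sum_superset[of F] lookup_add sum.distrib)
qed

lemma coeff_sum_diff:
  fixes f :: "'m \<Rightarrow>\<^sub>0 'k::ab_group_add"
  shows "coeff_sum A (f - g) = coeff_sum A f - coeff_sum A g"
  using coeff_sum_add[of A "f - g" g] by simp

lemma coeff_sum_single: "coeff_sum A (Poly_Mapping.single m a) = (if m \<in> A then a else 0)"
  by (auto simp: coeff_sum_def)

lemma coeff_sum_singleton: "coeff_sum {m} f = Poly_Mapping.lookup f m"
  by (cases "m \<in> Poly_Mapping.keys f") (auto simp: coeff_sum_def in_keys_iff)

lemma poly_mapping_single_induct [case_names zero add single]:
  assumes "P 0" "\<And>f g. P f \<Longrightarrow> P g \<Longrightarrow> P (f + g)" "\<And>m a. P (Poly_Mapping.single m a)"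
  shows "P (f :: 'm \<Rightarrow>\<^sub>0 'k::comm_monoid_add)"
proof -
  have "P (\<Sum>m\<in>F. Poly_Mapping.single m (Poly_Mapping.lookup f m))" if "finite F" for F
    using that by (induction F rule: finite_induct) (use assms in auto)
  moreover have "f = (\<Sum>m\<in>Poly_Mapping.keys f. Poly_Mapping.single m (Poly_Mapping.lookup f m))"
    by (rule poly_mapping_eqI)
      (auto simp: lookup_sum lookup_single when_def in_keys_iff sum.delta)
  ultimately show ?thesis
    by (metis finite_keys)
qed

lemma coeff_sum_mult_single:
  fixes f :: "'m::comm_monoid_add \<Rightarrow>\<^sub>0 'k::comm_ring_1"
  shows "coeff_sum A (Poly_Mapping.single u a * f) = a * coeff_sum {m. u + m \<in> A} f"
proof (induction f rule: poly_mapping_single_induct)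
  case (single m b)
  then show ?case
    by (simp add: mult_single coeff_sum_single)
qed (simp_all add: distrib_left coeff_sum_add)

section \<open>Monomials in four variables\<close>

lemma UNIV_four: "UNIV = {1, 2, 3, 4 :: 4}"
proof -
  have "x \<in> {1, 2, 3, 4}" for x :: 4
  proof (induction x)
    case (of_int z)
    then have "z = 0 \<or> z = 1 \<or> z = 2 \<or> z = 3"
      by auto
    then show ?case
      by auto
  qed
  then show ?thesis
    by blast
qed

lemma sum_four: "(\<Sum>i\<in>UNIV. g (i :: 4)) = g 1 + g 2 + g 3 + (g 4 :: 'a::comm_monoid_add)"
  unfolding UNIV_four by (simp add: ac_simps)

lemma prod_four: "(\<Prod>i\<in>UNIV. g (i :: 4)) = g 1 * g 2 * g 3 * (g 4 :: 'a::comm_monoid_mult)"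
  unfolding UNIV_four by (simp add: ac_simps)

definition mon :: "nat \<Rightarrow> nat \<Rightarrow> nat \<Rightarrow> nat \<Rightarrow> (4 \<Rightarrow>\<^sub>0 nat)" where
  "mon p q r t = Poly_Mapping.single 1 p + Poly_Mapping.single 2 q
     + Poly_Mapping.single 3 r + Poly_Mapping.single 4 t"

lemma lookup_mon [simp]:
  "Poly_Mapping.lookup (mon p q r t) 1 = p" "Poly_Mapping.lookup (mon p q r t) 2 = q"
  "Poly_Mapping.lookup (mon p q r t) 3 = r" "Poly_Mapping.lookup (mon p q r t) 4 = t"
  by (simp_all add: mon_def lookup_add lookup_single)

lemma mon_eqI:
  assumes "Poly_Mapping.lookup m 1 = Poly_Mapping.lookup m' 1" "Poly_Mapping.lookup m 2 = Poly_Mapping.lookup m' 2"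
    "Poly_Mapping.lookup m 3 = Poly_Mapping.lookup m' 3" "Poly_Mapping.lookup m 4 = Poly_Mapping.lookup m' (4 :: 4)"
  shows "m = m'"
proof (rule poly_mapping_eqI)
  show "Poly_Mapping.lookup m i = Poly_Mapping.lookup m' i" for i
    using UNIV_four assms by (cases "i = 1"; cases "i = 2"; cases "i = 3"; cases "i = 4") auto
qed

lemma mon_inject [simp]: "mon p q r t = mon p' q' r' t' \<longleftrightarrow> p = p' \<and> q = q' \<and> r = r' \<and> t = t'"
  by (metis lookup_mon)

lemma mon_cases: obtains p q r t where "m = mon p q r t"
  by (metis mon_eqI lookup_mon)

lemma mon_add [simp]: "mon p q r t + mon p' q' r' t' = mon (p + p') (q + q') (r + r') (t + t')"
  by (rule mon_eqI) (simp_all add: lookup_add)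

lemma mon_zero [simp]: "mon 0 0 0 0 = 0"
  by (simp add: mon_def)

lemma mon_deg_mon [simp]: "mon_deg (mon p q r t) = p + q + r + t"
  by (simp add: mon_deg_def sum_four)

lemma mon_deg_add: "mon_deg (u + m) = mon_deg u + mon_deg m"
  by (simp add: mon_deg_def lookup_add sum.distrib)

lemma pvar_power: "pvar i ^ k = Poly_Mapping.single (Poly_Mapping.single i k) 1"
  by (induction k) (simp_all add: pvar_def mult_single flip: single_add)

lemma mon_single:
  "Poly_Mapping.single 1 k = mon k 0 0 0" "Poly_Mapping.single 2 k = mon 0 k 0 0"
  "Poly_Mapping.single 3 k = mon 0 0 k 0" "Poly_Mapping.single 4 k = mon 0 0 0 k"
  by (simp_all add: mon_def)

lemma pvar_one: "pvar 1 = Poly_Mapping.single (mon 1 0 0 0) 1"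
  using pvar_power[of 1 1] by (simp add: mon_single)

section \<open>The polynomial ring and its quotients\<close>

lemma poly_ring4_presented: "presented_ring (poly_ring4 :: 'k::comm_ring_1 poly4 ring) (\<lambda>f. f)"
proof -
  interpret cring "poly_ring4 :: 'k poly4 ring"
    unfolding poly_ring4_def by (rule cring_from_type_algebra)
  show ?thesis
    by unfold_locales (auto simp: poly_ring4_def ring_of_type_algebra_def)
qed

lemma quotient_presented:
  fixes J :: "'k::comm_ring_1 poly4 set"
  assumes J: "ideal J poly_ring4"
  shows "presented_ring (poly_ring4 Quot J) (\<lambda>f. J +>\<^bsub>poly_ring4\<^esub> f)"
    and "J +>\<^bsub>poly_ring4\<^esub> f = \<zero>\<^bsub>poly_ring4 Quot J\<^esub> \<longleftrightarrow> f \<in> J"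
proof -
  interpret P: presented_ring "poly_ring4 :: 'k poly4 ring" "\<lambda>f. f"
    by (rule poly_ring4_presented)
  interpret J: ideal J poly_ring4
    by (rule J)
  interpret Q: cring "poly_ring4 Quot J"
    using J.quotient_is_cring P.is_cring by blast
  note hom = J.rcos_ring_hom
  show "presented_ring (poly_ring4 Quot J) (\<lambda>f. J +>\<^bsub>poly_ring4\<^esub> f)"
  proof
    fix f g :: "'k poly4"
    show "J +>\<^bsub>poly_ring4\<^esub> f \<in> carrier (poly_ring4 Quot J)"
      using ring_hom_closed[OF hom P.closed] .
    show "J +>\<^bsub>poly_ring4\<^esub> (f + g) = (J +>\<^bsub>poly_ring4\<^esub> f) \<oplus>\<^bsub>poly_ring4 Quot J\<^esub> (J +>\<^bsub>poly_ring4\<^esub> g)"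
      using ring_hom_add[OF hom P.closed P.closed] P.pi_add by simp
    show "J +>\<^bsub>poly_ring4\<^esub> (f * g) = (J +>\<^bsub>poly_ring4\<^esub> f) \<otimes>\<^bsub>poly_ring4 Quot J\<^esub> (J +>\<^bsub>poly_ring4\<^esub> g)"
      using ring_hom_mult[OF hom P.closed P.closed] P.pi_mult by simp
    show "J +>\<^bsub>poly_ring4\<^esub> 1 = \<one>\<^bsub>poly_ring4 Quot J\<^esub>"
      using ring_hom_one[OF hom] P.pi_one by simp
  next
    show "\<exists>a. x = J +>\<^bsub>poly_ring4\<^esub> a" if "x \<in> carrier (poly_ring4 Quot J)" for x
      using that by (auto simp: FactRing_def A_RCOSETS_def RCOSETS_def a_r_coset_def)
  qed
  show "J +>\<^bsub>poly_ring4\<^esub> f = \<zero>\<^bsub>poly_ring4 Quot J\<^esub> \<longleftrightarrow> f \<in> J"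
    using P.a_rcos_zero[OF J] J.rcos_const_imp_mem[OF P.closed] by (auto simp: FactRing_def)
qed

section \<open>The graded ideal of a monomial curve\<close>

definition weight :: "(4 \<Rightarrow> nat) \<Rightarrow> (4 \<Rightarrow>\<^sub>0 nat) \<Rightarrow> nat" where
  "weight n m = (\<Sum>i\<in>UNIV. Poly_Mapping.lookup m i * n i)"

lemma weight_mon [simp]: "weight n (mon p q r t) = p * n 1 + q * n 2 + r * n 3 + t * n 4"
  by (simp add: weight_def sum_four)

lemma weight_add: "weight n (u + m) = weight n u + weight n m"
  by (simp add: weight_def lookup_add sum.distrib algebra_simps)

lemma curve_hom_coeff: "Polynomial.coeff (curve_hom n f) s = coeff_sum {m. weight n m = s} f"
proof -
  have "(\<Prod>i\<in>UNIV. Polynomial.monom 1 (n i) ^ Poly_Mapping.lookup m i) = Polynomial.monom (1::'a) (weight n m)" for m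
    by (simp add: prod_four weight_def sum_four monom_power mult_monom ac_simps)
  then have "Polynomial.coeff (curve_hom n f) s
      = (\<Sum>m\<in>Poly_Mapping.keys f. if m \<in> {m. weight n m = s} then Poly_Mapping.lookup f m else 0)"
    unfolding curve_hom_def by (auto simp: coeff_sum intro!: sum.cong)
  also have "\<dots> = coeff_sum {m. weight n m = s} f"
    unfolding coeff_sum_def by (rule sum.inter_restrict[symmetric]) simp
  finally show ?thesis .
qed

lemma curve_ideal_iff: "f \<in> curve_ideal n \<longleftrightarrow> (\<forall>s. coeff_sum {m. weight n m = s} f = 0)"
  by (simp add: curve_ideal_def poly_eq_iff curve_hom_coeff)

lemma binomial_in_curve_ideal:
  "Poly_Mapping.single u 1 - Poly_Mapping.single v 1 \<in> (curve_ideal n :: 'k::field poly4 set) \<longleftrightarrow> weight n u = weight n v"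
  by (auto simp: curve_ideal_iff coeff_sum_diff coeff_sum_single)

text \<open>
  The monomials of weight \<open>s\<close> are the factorizations of \<open>s\<close> in the numerical semigroup; those in
  \<open>longest n s\<close> are the ones whose images in the tangent cone do not vanish.
\<close>

definition longest :: "(4 \<Rightarrow> nat) \<Rightarrow> nat \<Rightarrow> (4 \<Rightarrow>\<^sub>0 nat) set" where
  "longest n s = {m. weight n m = s \<and> (\<forall>m'. weight n m' = s \<longrightarrow> mon_deg m' \<le> mon_deg m)}"

text \<open>This is the kernel of the map from polynomials onto the associated graded ring of the semigroup ring.\<close>

definition cone_ideal :: "(4 \<Rightarrow> nat) \<Rightarrow> 'k::comm_ring_1 poly4 set" where
  "cone_ideal n = {f. \<forall>s. coeff_sum (longest n s) f = 0}"

text \<open>Part of a longest factorization can be replaced by any factorization of equal weight and length.\<close>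

lemma longest_add:
  assumes "u + m \<in> longest n s"
  shows "{m'. u + m' \<in> longest n s} = longest n (weight n m)" "m \<in> longest n (weight n m)"
proof -
  have s: "weight n u + weight n m = s"
    and max: "\<And>m'. weight n m' = s \<Longrightarrow> mon_deg m' \<le> mon_deg u + mon_deg m"
    using assms by (auto simp: longest_def weight_add mon_deg_add)
  have max': "mon_deg m' \<le> mon_deg m" if "weight n m' = weight n m" for m'
    using max[of "u + m'"] s that by (simp add: weight_add mon_deg_add)
  then show "m \<in> longest n (weight n m)"
    by (simp add: longest_def)
  show "{m'. u + m' \<in> longest n s} = longest n (weight n m)"
  proof (intro equalityI subsetI)
    fix m'
    assume "m' \<in> {m'. u + m' \<in> longest n s}"
    then have "weight n m' = weight n m" "mon_deg (u + m) \<le> mon_deg (u + m')"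
      using assms s by (auto simp: longest_def weight_add)
    then have "weight n m' = weight n m" "mon_deg m \<le> mon_deg m'"
      by (simp_all add: mon_deg_add)
    then show "m' \<in> longest n (weight n m)"
      using max' by (fastforce simp: longest_def)
  next
    fix m'
    assume m': "m' \<in> longest n (weight n m)"
    then have "weight n m' = weight n m" "mon_deg m \<le> mon_deg m'"
      by (auto simp: longest_def)
    then show "m' \<in> {m'. u + m' \<in> longest n s}"
      using s max by (fastforce simp: longest_def weight_add mon_deg_add)
  qed
qed

lemma cone_ideal_mult_single:
  assumes "f \<in> cone_ideal n"
  shows "Poly_Mapping.single u a * f \<in> cone_ideal n"
proof -
  have "coeff_sum {m. u + m \<in> longest n s} f = 0" for s
  proof (cases "\<exists>m. u + m \<in> longest n s")
    case True
    then show ?thesis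
      using longest_add(1) assms by (fastforce simp: cone_ideal_def)
  qed simp
  then show ?thesis
    by (simp add: cone_ideal_def coeff_sum_mult_single)
qed

lemma cone_ideal_closed:
  "0 \<in> cone_ideal n"
  "f \<in> cone_ideal n \<Longrightarrow> g \<in> cone_ideal n \<Longrightarrow> f + g \<in> cone_ideal n"
  "f \<in> cone_ideal n \<Longrightarrow> g * f \<in> cone_ideal n"
proof -
  show 0: "0 \<in> cone_ideal n"
    by (simp add: cone_ideal_def)
  show add: "f + g \<in> cone_ideal n" if "f \<in> cone_ideal n" "g \<in> cone_ideal n" for f g
    using that by (simp add: cone_ideal_def coeff_sum_add)
  show "g * f \<in> cone_ideal n" if "f \<in> cone_ideal n"
    by (induction g rule: poly_mapping_single_induct)
      (use 0 add cone_ideal_mult_single[OF that] in \<open>auto simp: distrib_right\<close>)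
qed

lemma cone_ideal_ideal: "ideal (cone_ideal n) poly_ring4"
proof -
  have "ideal ((\<lambda>f. f) ` cone_ideal n) poly_ring4"
    by (rule presented_ring.ideal_image[OF poly_ring4_presented]) (fact cone_ideal_closed)+
  then show ?thesis
    by simp
qed

lemma lookup_least_form:
  "Poly_Mapping.lookup (least_form f) m =
    (if mon_deg m = Min (mon_deg ` Poly_Mapping.keys f) then Poly_Mapping.lookup f m else 0)"
  by (auto simp: least_form_def lookup_sum lookup_single when_def in_keys_iff sum.delta)

text \<open>
  Let \<open>d\<close> be the least degree in \<open>f\<close>. If the longest monomials of weight \<open>s\<close> have degree \<open>d\<close>, then
  they account for all terms of weight \<open>s\<close> in \<open>f\<close>, whose coefficients add up to \<open>0\<close>; otherwise none
  of them occurs in the least form.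
\<close>

lemma least_form_in_cone_ideal:
  assumes "f \<in> curve_ideal n"
  shows "least_form f \<in> cone_ideal n"
proof -
  define d where "d = Min (mon_deg ` Poly_Mapping.keys f)"
  have ge: "d \<le> mon_deg m" if "m \<in> Poly_Mapping.keys f" for m
    unfolding d_def using that by simp
  have "coeff_sum (longest n s) (least_form f) = 0" for s
  proof -
    have sub: "Poly_Mapping.keys (least_form f) \<subseteq> Poly_Mapping.keys f"
      by (auto simp: in_keys_iff lookup_least_form split: if_splits)
    have "coeff_sum (longest n s) (least_form f)
        = (\<Sum>m\<in>Poly_Mapping.keys f \<inter> longest n s. if m \<in> {m. mon_deg m = d} then Poly_Mapping.lookup f m else 0)"
      unfolding coeff_sum_superset[OF finite_keys sub]
      by (intro sum.cong) (auto simp: lookup_least_form d_def)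
    also have "\<dots> = coeff_sum (longest n s \<inter> {m. mon_deg m = d}) f"
      unfolding coeff_sum_def by (subst sum.inter_restrict[symmetric]) (auto simp: Int_assoc)
    also have "\<dots> = 0"
    proof (cases "longest n s \<inter> {m. mon_deg m = d} = {}")
      case False
      then obtain l where l: "l \<in> longest n s" "mon_deg l = d"
        by auto
      have "m \<in> longest n s \<and> mon_deg m = d" if "m \<in> Poly_Mapping.keys f" "weight n m = s" for m
      proof -
        have "mon_deg m = d"
          using l ge that by (intro antisym) (auto simp: longest_def)
        then show ?thesis
          using l that by (simp add: longest_def)
      qed
      then have "coeff_sum (longest n s \<inter> {m. mon_deg m = d}) f = coeff_sum {m. weight n m = s} f"
        by (intro coeff_sum_cong) (auto simp: longest_def)
      then show ?thesis
        using assms by (simp add: curve_ideal_iff)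
    qed simp
    finally show ?thesis .
  qed
  then show ?thesis
    by (simp add: cone_ideal_def)
qed

lemma least_form_binomial:
  fixes u v :: "4 \<Rightarrow>\<^sub>0 nat"
  assumes "u \<noteq> v"
  defines "f \<equiv> Poly_Mapping.single u 1 - (Poly_Mapping.single v 1 :: 'k::field poly4)"
  shows "mon_deg u < mon_deg v \<Longrightarrow> least_form f = Poly_Mapping.single u 1"
    and "mon_deg u = mon_deg v \<Longrightarrow> least_form f = f"
proof -
  have keys: "Poly_Mapping.keys f = {u, v}"
    using assms by (auto simp: in_keys_iff f_def lookup_minus lookup_single when_def split: if_splits)
  have lk: "Poly_Mapping.lookup f m = (if m = u then 1 else if m = v then -1 else 0)" for m
    using assms by (auto simp: f_def lookup_minus lookup_single when_def)
  show "least_form f = Poly_Mapping.single u 1" if "mon_deg u < mon_deg v"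
    by (rule poly_mapping_eqI) (use that in \<open>auto simp: lookup_least_form keys lk lookup_single when_def\<close>)
  show "least_form f = f" if "mon_deg u = mon_deg v"
    by (rule poly_mapping_eqI) (use that in \<open>auto simp: lookup_least_form keys lk\<close>)
qed

text \<open>
  Each \<open>f\<close> in \<open>cone_ideal n\<close> is reduced to \<open>0\<close>, one monomial after the other, by the least forms of
  binomials \<open>u - v\<close> of the curve: \<open>u\<close> is such a form if \<open>v\<close> is longer, and \<open>u - v\<close> if they have
  the same length.
\<close>

lemma initial_ideal_curve_ideal:
  "initial_ideal (curve_ideal n :: 'k::field poly4 set) = cone_ideal n"
proof
  interpret P: presented_ring "poly_ring4 :: 'k poly4 ring" "\<lambda>f. f"
    by (rule poly_ring4_presented)
  let ?H = "initial_ideal (curve_ideal n :: 'k poly4 set)"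
  show "?H \<subseteq> cone_ideal n"
    unfolding initial_ideal_def by (rule P.genideal_minimal[OF cone_ideal_ideal]) (use least_form_in_cone_ideal in auto)
  have carrier: "carrier (poly_ring4 :: 'k poly4 ring) = UNIV"
    using P.closed by auto
  have H: "ideal ?H poly_ring4"
    unfolding initial_ideal_def by (rule P.genideal_ideal) (simp add: carrier)
  have form: "least_form f \<in> ?H" if "f \<in> curve_ideal n" for f
    unfolding initial_ideal_def using that P.genideal_self[of "least_form ` curve_ideal n"] carrier by auto
  have short: "Poly_Mapping.single u a \<in> ?H" if u: "u \<notin> longest n (weight n u)" for u a
  proof -
    obtain v where "weight n v = weight n u" "mon_deg u < mon_deg v"
      using u by (auto simp: longest_def not_le)
    then have "Poly_Mapping.single u 1 \<in> ?H"
      using form[of "Poly_Mapping.single u 1 - Poly_Mapping.single v 1"]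
        least_form_binomial(1)[of u v, where 'k = 'k]
      by (cases "u = v") (auto simp: binomial_in_curve_ideal)
    then show ?thesis
      using P.ideal_mult[OF H, of "Poly_Mapping.single u 1" "Poly_Mapping.single 0 a"] by (simp add: mult_single)
  qed
  have same: "Poly_Mapping.single u a - Poly_Mapping.single v a \<in> ?H"
    if "u \<in> longest n s" "v \<in> longest n s" "u \<noteq> v" for u v s a
  proof -
    have "weight n v = weight n u" "mon_deg u = mon_deg v"
      using that by (auto simp: longest_def intro: antisym)
    then have "Poly_Mapping.single u 1 - Poly_Mapping.single v 1 \<in> ?H"
      using form[of "Poly_Mapping.single u 1 - Poly_Mapping.single v 1"]
        least_form_binomial(2)[of u v, where 'k = 'k] that
      by (auto simp: binomial_in_curve_ideal)
    then show ?thesis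
      using P.ideal_mult[OF H, of "Poly_Mapping.single u 1 - Poly_Mapping.single v 1" "Poly_Mapping.single 0 a"]
      by (simp add: mult_single right_diff_distrib)
  qed
  have "f \<in> ?H" if "f \<in> cone_ideal n" for f
    using that
  proof (induction "card (Poly_Mapping.keys f)" arbitrary: f rule: less_induct)
    case less
    have step: "f \<in> ?H"
      if h: "h \<in> ?H" and m: "m \<in> Poly_Mapping.keys f" and gone: "Poly_Mapping.lookup (f - h) m = 0"
        and others: "Poly_Mapping.keys h \<subseteq> Poly_Mapping.keys f" for h m
    proof -
      have "h \<in> cone_ideal n"
        using h \<open>?H \<subseteq> cone_ideal n\<close> by blast
      then have "f - h \<in> cone_ideal n"
        using less.prems by (simp add: cone_ideal_def coeff_sum_diff)
      moreover have "Poly_Mapping.keys (f - h) \<subset> Poly_Mapping.keys f"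
        using others m gone Poly_Mapping.keys_diff[of f h] by (auto simp: in_keys_iff[of m "f - h"])
      then have "card (Poly_Mapping.keys (f - h)) < card (Poly_Mapping.keys f)"
        by (intro psubset_card_mono) auto
      ultimately have "f - h \<in> ?H"
        by (rule less.hyps[rotated])
      then show ?thesis
        using P.ideal_add[OF H _ h, of "f - h"] by simp
    qed
    show ?case
    proof (cases "f = 0")
      case True
      then show ?thesis
        using P.ideal_zero_mem[OF H] by simp
    next
      case False
      then obtain m where m: "m \<in> Poly_Mapping.keys f"
        by (metis all_not_in_conv keys_eq_empty)
      show ?thesis
      proof (cases "m \<in> longest n (weight n m)")
        case False
        then show ?thesis
          using step[OF short[OF False, of "Poly_Mapping.lookup f m"] m] m
          by (auto simp: lookup_minus in_keys_iff)
      next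
        case True
        have "\<exists>v\<in>Poly_Mapping.keys f \<inter> longest n (weight n m). v \<noteq> m"
        proof (rule ccontr)
          assume "\<not> ?thesis"
          then have "Poly_Mapping.keys f \<inter> longest n (weight n m) = {m}"
            using m True by auto
          then have "coeff_sum (longest n (weight n m)) f = Poly_Mapping.lookup f m"
            by (simp add: coeff_sum_def)
          then show False
            using less.prems m by (simp add: cone_ideal_def in_keys_iff)
        qed
        then obtain v where v: "v \<in> Poly_Mapping.keys f" "v \<in> longest n (weight n m)" "m \<noteq> v"
          by auto
        show ?thesis
          by (rule step[OF same[OF True v(2,3), of "Poly_Mapping.lookup f m"] m])
            (use m v in \<open>auto simp: lookup_minus lookup_single when_def in_keys_iff split: if_splits\<close>)
      qed
    qed
  qed
  then show "cone_ideal n \<subseteq> ?H"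
    by blast
qed

section \<open>The tangent cone as a thickened line\<close>

definition on_line :: "(4 \<Rightarrow>\<^sub>0 nat) \<Rightarrow> bool" where
  "on_line m \<longleftrightarrow> Poly_Mapping.lookup m 2 = 0 \<and> Poly_Mapping.lookup m 3 = 0 \<and> Poly_Mapping.lookup m 4 = 0"

lemma eq_power_iff: "m = mon k 0 0 0 \<longleftrightarrow> on_line m \<and> Poly_Mapping.lookup m 1 = k"
  by (auto simp: on_line_def intro: mon_eqI)

definition line_part :: "'k::comm_ring_1 poly4 \<Rightarrow> 'k poly" where
  "line_part f = (\<Sum>m\<in>Poly_Mapping.keys f.
     if on_line m then Polynomial.monom (Poly_Mapping.lookup f m) (Poly_Mapping.lookup m 1) else 0)"

lemma coeff_line_part: "Polynomial.coeff (line_part f) k = Poly_Mapping.lookup f (mon k 0 0 0)"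
proof -
  have "Polynomial.coeff (line_part f) k
      = (\<Sum>m\<in>Poly_Mapping.keys f. if m = mon k 0 0 0 then Poly_Mapping.lookup f m else 0)"
    unfolding line_part_def coeff_sum by (intro sum.cong) (auto simp: eq_power_iff)
  then show ?thesis
    by (simp add: sum.delta in_keys_iff)
qed

lemma line_part_add: "line_part (f + g) = line_part f + line_part g"
  by (rule poly_eqI) (simp add: coeff_line_part lookup_add)

lemma line_part_single:
  "line_part (Poly_Mapping.single (mon p q r t) a) = (if q = 0 \<and> r = 0 \<and> t = 0 then Polynomial.monom a p else 0)"
  by (rule poly_eqI) (auto simp: coeff_line_part lookup_single when_def)

lemma line_part_mult: "line_part (f * g) = line_part f * line_part g"
proof (induction f rule: poly_mapping_single_induct)
  case (single u a)
  show ?case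
  proof (induction g rule: poly_mapping_single_induct)
    case (single v b)
    obtain p q r t where u: "u = mon p q r t"
      by (rule mon_cases)
    obtain p' q' r' t' where v: "v = mon p' q' r' t'"
      by (rule mon_cases)
    show ?case
      by (simp add: u v mult_single line_part_single mult_monom)
  qed (simp_all add: line_part_add distrib_left, simp add: line_part_def)
qed (simp_all add: line_part_add distrib_right, simp add: line_part_def)

definition line_poly :: "'k::comm_ring_1 poly \<Rightarrow> 'k poly4" where
  "line_poly p = poly (map_poly (Poly_Mapping.single 0) p) (pvar 1)"

lemma line_poly_0 [simp]: "line_poly 0 = 0"
  by (simp add: line_poly_def)

lemma line_poly_pCons: "line_poly (pCons a p) = Poly_Mapping.single 0 a + pvar 1 * line_poly p"
  by (simp add: line_poly_def map_poly_pCons)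

lemma line_poly_const: "line_poly [:a:] = Poly_Mapping.single 0 a"
  by (simp add: line_poly_pCons)

lemma line_poly_var: "line_poly [:0, 1:] = pvar 1"
  by (simp add: line_poly_pCons)

lemma line_poly_add: "line_poly (p + q) = line_poly p + line_poly q"
  by (induction p q rule: poly_induct2) (simp_all add: line_poly_pCons single_add algebra_simps)

lemma line_poly_smult: "line_poly (Polynomial.smult a p) = Poly_Mapping.single 0 a * line_poly p"
  by (induction p) (simp_all add: line_poly_pCons mult_single algebra_simps)

lemma line_poly_mult: "line_poly (p * q) = line_poly p * line_poly q"
  by (induction p) (simp_all add: line_poly_pCons line_poly_add line_poly_smult algebra_simps)

lemma line_part_line_poly: "line_part (line_poly p) = p"
proof (induction p)
  case (pCons a p)
  have "line_part (Poly_Mapping.single 0 a) = [:a:]" "line_part (pvar 1 :: 'a poly4) = [:0, 1:]"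
    using line_part_single[of 0 0 0 0 a] line_part_single[of 1 0 0 0 "1 :: 'a"]
    by (simp_all add: pvar_one monom_0 monom_Suc)
  then show ?case
    by (simp add: line_poly_pCons line_part_add line_part_mult pCons)
qed (simp add: line_part_def)

locale monomial_curve =
  fixes n :: "4 \<Rightarrow> nat"
  assumes n_pos: "0 < n 1" and n_min: "n 1 < n 2" "n 1 < n 3" "n 1 < n 4"
begin

lemma finite_weight: "finite {m. weight n m = s}"
proof -
  have "m \<in> (\<lambda>(p, q, r, t). mon p q r t) ` ({..s} \<times> {..s} \<times> {..s} \<times> {..s})" if "weight n m = s" for m
  proof -
    obtain p q r t where m: "m = mon p q r t"
      by (rule mon_cases)
    have le: "k \<le> k * n i" if "i \<in> {1, 2, 3, 4}" for k i
      using that n_pos n_min by auto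
    have "p * n 1 + q * n 2 + r * n 3 + t * n 4 = s"
      using that by (simp add: m)
    moreover have "p \<le> p * n 1" "q \<le> q * n 2" "r \<le> r * n 3" "t \<le> t * n 4"
      by (rule le, simp)+
    ultimately have "p \<le> s" "q \<le> s" "r \<le> s" "t \<le> s"
      by linarith+
    then show ?thesis
      unfolding m by (intro image_eqI[of _ _ "(p, q, r, t)"]) auto
  qed
  then have "{m. weight n m = s} \<subseteq> (\<lambda>(p, q, r, t). mon p q r t) ` ({..s} \<times> {..s} \<times> {..s} \<times> {..s})"
    by blast
  then show ?thesis
    by (rule finite_subset[of _ "(\<lambda>(p, q, r, t). mon p q r t) ` ({..s} \<times> {..s} \<times> {..s} \<times> {..s})"]) auto
qed

lemma longest_exists:
  assumes "weight n m = s"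
  obtains l where "l \<in> longest n s"
proof -
  have fin: "finite (mon_deg ` {m. weight n m = s})" and ne: "mon_deg ` {m. weight n m = s} \<noteq> {}"
    using finite_weight assms by auto
  obtain l where "weight n l = s" "mon_deg l = Max (mon_deg ` {m. weight n m = s})"
    using Max_in[OF fin ne] by auto
  then have "l \<in> longest n s"
    using Max_ge[OF fin] by (auto simp: longest_def)
  then show ?thesis
    by (rule that)
qed

text \<open>
  Each variable has at least the weight \<open>n 1\<close>, and each variable but the first has a larger one.
  So a power of the first variable is the only longest monomial of its weight.
\<close>

lemma deg_le_weight:
  "mon_deg m * n 1 \<le> weight n m"
  "mon_deg m * n 1 = weight n m \<Longrightarrow> m = mon (mon_deg m) 0 0 0"
proof -
  obtain p q r t where m: "m = mon p q r t"
    by (rule mon_cases)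
  have le: "q * n 1 \<le> q * n 2" "r * n 1 \<le> r * n 3" "t * n 1 \<le> t * n 4"
    using n_min by simp_all
  have w: "weight n m = p * n 1 + q * n 2 + r * n 3 + t * n 4"
    "mon_deg m * n 1 = p * n 1 + q * n 1 + r * n 1 + t * n 1"
    by (simp_all add: m algebra_simps)
  show "mon_deg m * n 1 \<le> weight n m"
    using le unfolding w by linarith
  show "m = mon (mon_deg m) 0 0 0" if "mon_deg m * n 1 = weight n m"
  proof -
    have "q * n 1 = q * n 2" "r * n 1 = r * n 3" "t * n 1 = t * n 4"
      using le that unfolding w by linarith+
    then show ?thesis
      using n_min by (simp add: m)
  qed
qed

lemma longest_line: "longest n (k * n 1) = {mon k 0 0 0}"
proof -
  have deg: "mon_deg m \<le> k" if "weight n m = k * n 1" for m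
    using deg_le_weight(1)[of m] that n_pos by simp
  have "m = mon k 0 0 0" if m: "m \<in> longest n (k * n 1)" for m
  proof -
    have "weight n m = k * n 1"
      using m by (simp add: longest_def)
    moreover have "mon_deg (mon k 0 0 0) \<le> mon_deg m"
      using m unfolding longest_def by (elim CollectE conjE allE[of _ "mon k 0 0 0"]) simp
    ultimately have "mon_deg m = k"
      using deg[of m] by simp
    then show ?thesis
      using deg_le_weight(2)[of m] \<open>weight n m = k * n 1\<close> by simp
  qed
  moreover have "mon k 0 0 0 \<in> longest n (k * n 1)"
    using deg by (auto simp: longest_def)
  ultimately show ?thesis
    by blast
qed

lemma line_part_cone_ideal:
  assumes "f \<in> cone_ideal n"
  shows "line_part f = 0"
proof (rule poly_eqI)
  fix k
  have "coeff_sum (longest n (k * n 1)) f = 0"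
    using assms by (simp add: cone_ideal_def)
  then show "Polynomial.coeff (line_part f) k = Polynomial.coeff 0 k"
    by (simp add: longest_line coeff_sum_singleton coeff_line_part)
qed

text \<open>
  The power has the weight of a longer power of the first variable.
\<close>

lemma off_line_nilpotent:
  assumes "\<not> on_line m"
  shows "Poly_Mapping.single m a ^ n 1 \<in> cone_ideal n"
proof -
  obtain p q r t where m: "m = mon p q r t"
    by (rule mon_cases)
  have power: "Poly_Mapping.single m a ^ k = Poly_Mapping.single (mon (k * p) (k * q) (k * r) (k * t)) (a ^ k)" for k
    by (induction k) (simp_all add: m mult_single)
  define w where "w = mon (n 1 * p) (n 1 * q) (n 1 * r) (n 1 * t)"
  have w: "weight n w = weight n m * n 1" "mon_deg w = mon_deg m * n 1"
    by (simp_all add: w_def m algebra_simps)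
  have "mon_deg m * n 1 \<noteq> weight n m"
    using deg_le_weight(2)[of m] assms by (auto simp: eq_power_iff)
  then have "mon_deg w \<noteq> weight n m"
    by (simp add: w)
  have "w \<notin> longest n s" for s
  proof
    assume l: "w \<in> longest n s"
    then have "s = weight n m * n 1"
      by (simp add: longest_def w)
    then have "mon_deg w = weight n m"
      using l longest_line by auto
    then show False
      using \<open>mon_deg w \<noteq> weight n m\<close> by simp
  qed
  then show ?thesis
    unfolding power by (simp add: cone_ideal_def coeff_sum_single flip: w_def)
qed

definition cone_class :: "'k::comm_ring_1 poly4 \<Rightarrow> 'k poly4 set" where
  "cone_class f = cone_ideal n +>\<^bsub>poly_ring4\<^esub> f"

sublocale cone: presented_ring "poly_ring4 Quot cone_ideal n :: 'k::field poly4 set ring" cone_class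
  unfolding cone_class_def by (rule quotient_presented(1)[OF cone_ideal_ideal])

lemma cone_class_zero:
  "cone_class f = \<zero>\<^bsub>poly_ring4 Quot cone_ideal n\<^esub> \<longleftrightarrow> f \<in> (cone_ideal n :: 'k::field poly4 set)"
  unfolding cone_class_def by (rule quotient_presented(2)[OF cone_ideal_ideal])

lemma line_part_nilpotent:
  fixes f :: "'k::field poly4"
  assumes "line_part f = 0"
  shows "\<exists>N. f ^ N \<in> cone_ideal n"
proof -
  let ?g = "\<lambda>m. Poly_Mapping.single m (Poly_Mapping.lookup f m)"
  have zero: "ideal {\<zero>\<^bsub>poly_ring4 Quot (cone_ideal n :: 'k poly4 set)\<^esub>} (poly_ring4 Quot (cone_ideal n :: 'k poly4 set))"
    by (rule cone.zeroideal)
  have "\<exists>N. (\<Sum>m\<in>F. ?g m) ^ N \<in> cone_ideal n" if "finite F" "F \<subseteq> Poly_Mapping.keys f" for F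
    using that
  proof (induction F rule: finite_induct)
    case empty
    have "(0 :: 'k poly4) ^ 1 \<in> cone_ideal n"
      by (simp add: cone_ideal_closed)
    then show ?case
      unfolding sum.empty by blast
  next
    case (insert m F)
    then obtain N where "(\<Sum>m\<in>F. ?g m) ^ N \<in> cone_ideal n"
      by auto
    moreover have "\<not> on_line m"
    proof
      assume "on_line m"
      then have "m = mon (Poly_Mapping.lookup m 1) 0 0 0"
        by (simp add: eq_power_iff)
      moreover have "Poly_Mapping.lookup f (mon (Poly_Mapping.lookup m 1) 0 0 0) = 0"
        unfolding coeff_line_part[symmetric] assms by simp
      ultimately have "Poly_Mapping.lookup f m = 0"
        by metis
      then show False
        using insert.prems by (simp add: in_keys_iff)
    qed
    then have "?g m ^ n 1 \<in> cone_ideal n"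
      by (rule off_line_nilpotent)
    ultimately have "(?g m + (\<Sum>m\<in>F. ?g m)) ^ (n 1 + N) \<in> cone_ideal n"
      using cone.radical_add[OF zero, of "?g m" "n 1" "\<Sum>m\<in>F. ?g m" N] by (simp add: cone_class_zero)
    then show ?case
      using insert.hyps by auto
  qed
  moreover have "f = (\<Sum>m\<in>Poly_Mapping.keys f. ?g m)"
    by (rule poly_mapping_eqI)
      (auto simp: lookup_sum lookup_single when_def in_keys_iff sum.delta)
  ultimately show ?thesis
    by (metis finite_keys subset_refl)
qed

sublocale cone: thickened_line "poly_ring4 Quot cone_ideal n :: 'k::field poly4 set ring" cone_class line_part line_poly
proof
  show "line_poly 1 = (1 :: 'k poly4)"
    using line_poly_const[of "1 :: 'k"] by (simp add: one_pCons)
qed (simp_all add: line_part_add line_part_mult line_part_cone_ideal cone_class_zero line_poly_add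
    line_poly_mult line_part_line_poly line_part_nilpotent)

section \<open>Regularity of the first variable\<close>

definition length_regular :: bool where
  "length_regular \<longleftrightarrow> (\<forall>s m. m \<in> longest n s \<longrightarrow> mon 1 0 0 0 + m \<in> longest n (s + n 1))"

text \<open>
  If \<open>x\<^sub>1\<close> times a longest monomial is no longer a longest one, then it vanishes in the graded ring.
  Otherwise the coefficient of \<open>f\<close> at \<open>s\<close> can be read off from that of \<open>x\<^sub>1 f\<close> at \<open>s + n 1\<close>.
\<close>

lemma length_regular_iff:
  "(\<forall>f. pvar 1 * f \<in> cone_ideal n \<longrightarrow> f \<in> (cone_ideal n :: 'k::field poly4 set)) \<longleftrightarrow> length_regular"
proof
  assume *: "\<forall>f. pvar 1 * f \<in> cone_ideal n \<longrightarrow> f \<in> (cone_ideal n :: 'k poly4 set)"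
  show length_regular
    unfolding length_regular_def
  proof (intro allI impI, rule ccontr)
    fix s m
    assume m: "m \<in> longest n s" and not: "mon 1 0 0 0 + m \<notin> longest n (s + n 1)"
    have "mon 1 0 0 0 + m \<notin> longest n s'" for s'
    proof
      assume "mon 1 0 0 0 + m \<in> longest n s'"
      moreover from this have "s' = s + n 1"
        using m by (auto simp: longest_def weight_add)
      ultimately show False
        using not by simp
    qed
    then have "pvar 1 * Poly_Mapping.single m 1 \<in> (cone_ideal n :: 'k poly4 set)"
      by (simp add: pvar_one cone_ideal_def mult_single coeff_sum_single)
    then have "Poly_Mapping.single m 1 \<in> (cone_ideal n :: 'k poly4 set)"
      using * by blast
    then show False
      using m by (auto simp: cone_ideal_def coeff_sum_single split: if_splits)
  qed
next
  assume reg: length_regular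
  show "\<forall>f. pvar 1 * f \<in> cone_ideal n \<longrightarrow> f \<in> (cone_ideal n :: 'k poly4 set)"
  proof (intro allI impI)
    fix f :: "'k poly4"
    assume f: "pvar 1 * f \<in> cone_ideal n"
    have "coeff_sum (longest n s) f = 0" for s
    proof (cases "longest n s = {}")
      case False
      then obtain m where "m \<in> longest n s"
        by blast
      then have "mon 1 0 0 0 + m \<in> longest n (s + n 1)" "weight n m = s"
        using reg by (auto simp: length_regular_def longest_def)
      then have "{m'. mon 1 0 0 0 + m' \<in> longest n (s + n 1)} = longest n s"
        using longest_add(1) by blast
      then show ?thesis
        using f coeff_sum_mult_single[of "longest n (s + n 1)" "mon 1 0 0 0" 1 f]
        by (simp add: cone_ideal_def pvar_one)
    qed simp
    then show "f \<in> cone_ideal n"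
      by (simp add: cone_ideal_def)
  qed
qed

lemma coeff_sum_shift:
  fixes f :: "'k::comm_ring_1 poly4"
  assumes length_regular
  shows "coeff_sum (longest n (s + k * n 1)) (pvar 1 ^ k * f) = coeff_sum (longest n s) f"
proof (induction k)
  case (Suc k)
  let ?s = "s + k * n 1"
  have "{m. mon 1 0 0 0 + m \<in> longest n (?s + n 1)} = longest n ?s"
  proof (intro equalityI subsetI)
    fix m
    assume "m \<in> {m. mon 1 0 0 0 + m \<in> longest n (?s + n 1)}"
    then have l: "mon 1 0 0 0 + m \<in> longest n (?s + n 1)"
      by simp
    then have "weight n (mon 1 0 0 0 + m) = ?s + n 1"
      by (simp add: longest_def)
    moreover have "m \<in> longest n (weight n m)"
      by (rule longest_add(2)[OF l])
    ultimately show "m \<in> longest n ?s"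
      by (simp add: weight_add)
  next
    fix m
    assume "m \<in> longest n ?s"
    then show "m \<in> {m. mon 1 0 0 0 + m \<in> longest n (?s + n 1)}"
      using assms by (simp add: length_regular_def)
  qed
  then show ?case
    using coeff_sum_mult_single[of "longest n (?s + n 1)" "mon 1 0 0 0" 1 "pvar 1 ^ k * f"] Suc.IH
    by (simp add: pvar_one mult.assoc add_ac)
qed simp

text \<open>
  Of all products of a term of \<open>p\<close> with a term of \<open>f\<close>, only that of the terms of degree \<open>d\<close> and of
  weight \<open>s\<close> reaches the weight \<open>s + d * n 1\<close>. Any bound \<open>d\<close> on the degree is admitted for the sake
  of the induction on \<open>p\<close>.
\<close>

lemma coeff_sum_line_poly_mult:
  fixes f :: "'k::comm_ring_1 poly4"
  assumes reg: length_regular and top: "\<And>t. s < t \<Longrightarrow> coeff_sum (longest n t) f = 0"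
    and "Polynomial.degree p \<le> d"
  shows "coeff_sum (longest n (s + d * n 1)) (line_poly p * f) = Polynomial.coeff p d * coeff_sum (longest n s) f"
  using assms(3)
proof (induction p arbitrary: d)
  case (pCons a p)
  have const: "coeff_sum (longest n t) (Poly_Mapping.single 0 a * f) = a * coeff_sum (longest n t) f" for t
    by (simp add: coeff_sum_mult_single)
  show ?case
  proof (cases d)
    case 0
    then have "p = 0"
      using pCons.prems by (simp split: if_splits)
    then show ?thesis
      by (simp add: 0 line_poly_const const)
  next
    case (Suc e)
    have "coeff_sum (longest n (s + e * n 1)) (line_poly p * f) = Polynomial.coeff p e * coeff_sum (longest n s) f"
      by (rule pCons.IH) (use pCons.prems Suc in \<open>simp split: if_splits\<close>)
    moreover have "coeff_sum (longest n (s + d * n 1)) f = 0"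
      by (rule top) (use Suc n_pos in simp)
    moreover have "coeff_sum (longest n (s + d * n 1)) (pvar 1 * (line_poly p * f))
        = coeff_sum (longest n (s + e * n 1)) (line_poly p * f)"
      using coeff_sum_shift[OF reg, of "s + e * n 1" 1 "line_poly p * f"] by (simp add: Suc add_ac)
    ultimately show ?thesis
      by (simp add: line_poly_pCons distrib_right coeff_sum_add const mult.assoc Suc)
  qed
qed simp

lemma finite_support: "finite {s. coeff_sum (longest n s) f \<noteq> 0}"
proof (rule finite_subset)
  show "{s. coeff_sum (longest n s) f \<noteq> 0} \<subseteq> weight n ` Poly_Mapping.keys f"
  proof
    fix s
    assume "s \<in> {s. coeff_sum (longest n s) f \<noteq> 0}"
    then have "Poly_Mapping.keys f \<inter> longest n s \<noteq> {}"
      by (auto simp: coeff_sum_def)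
    then show "s \<in> weight n ` Poly_Mapping.keys f"
      by (auto simp: longest_def)
  qed
qed simp

lemma line_poly_regular:
  fixes f :: "'k::field poly4"
  assumes reg: length_regular and p: "p \<noteq> 0" and f: "line_poly p * f \<in> cone_ideal n"
  shows "f \<in> cone_ideal n"
proof (rule ccontr)
  assume "f \<notin> cone_ideal n"
  define S where "S = {s. coeff_sum (longest n s) f \<noteq> 0}"
  have S: "finite S" "S \<noteq> {}"
    using finite_support \<open>f \<notin> cone_ideal n\<close> by (auto simp: S_def cone_ideal_def)
  have "coeff_sum (longest n t) f = 0" if "Max S < t" for t
    using Max_ge[OF S(1), of t] that by (auto simp: S_def)
  then have "coeff_sum (longest n (Max S + Polynomial.degree p * n 1)) (line_poly p * f)
      = lead_coeff p * coeff_sum (longest n (Max S)) f"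
    by (intro coeff_sum_line_poly_mult[OF reg]) auto
  moreover have "coeff_sum (longest n (Max S)) f \<noteq> 0"
    using Max_in[OF S] by (simp add: S_def)
  ultimately show False
    using p f by (simp add: cone_ideal_def)
qed

text \<open>
  The graded ring is then a finite free module over \<open>K[x\<^sub>1]\<close>, with at most one basis element for
  each residue class of weights modulo \<open>n 1\<close>. An ideal is generated by one element for each residue
  class that occurs, chosen with the least possible leading weight: a scalar times a power of \<open>x\<^sub>1\<close>
  times this element cancels the leading term of any other element of the ideal with leading weight
  in the same class.
\<close>

lemma noetherian_cone:
  assumes reg: length_regular
  shows "noetherian_ring (poly_ring4 Quot (cone_ideal n :: 'k::field poly4 set))" (is "noetherian_ring ?R")
proof (intro noetherian_ring.intro noetherian_ring_axioms.intro)
  show "ring ?R"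
    using cone.ring_axioms .
  fix A
  assume A: "ideal A ?R"
  let ?c = "\<lambda>s (f :: 'k poly4). coeff_sum (longest n s) f"
  define lead where "lead f s \<longleftrightarrow> ?c s f \<noteq> 0 \<and> (\<forall>t>s. ?c t f = 0)" for f s
  define L where "L i = {s. s mod n 1 = i \<and> (\<exists>f. cone_class f \<in> A \<and> lead f s)}" for i
  define g where "g i = (SOME f. cone_class f \<in> A \<and> lead f (LEAST s. s \<in> L i))" for i
  define B where "B = genideal ?R ((\<lambda>i. cone_class (g i)) ` {i. i < n 1 \<and> L i \<noteq> {}})"
  have g: "cone_class (g i) \<in> A" "lead (g i) (LEAST s. s \<in> L i)" if "L i \<noteq> {}" for i
  proof -
    have "(LEAST s. s \<in> L i) \<in> L i"
      using that by (metis LeastI ex_in_conv)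
    then have "\<exists>f. cone_class f \<in> A \<and> lead f (LEAST s. s \<in> L i)"
      unfolding L_def by blast
    from someI_ex[OF this] show "cone_class (g i) \<in> A" "lead (g i) (LEAST s. s \<in> L i)"
      unfolding g_def by blast+
  qed
  have sub: "(\<lambda>i. cone_class (g i)) ` {i. i < n 1 \<and> L i \<noteq> {}} \<subseteq> carrier ?R"
    using cone.closed by blast
  have B: "ideal B ?R"
    unfolding B_def by (rule cone.genideal_ideal[OF sub])
  have gB: "cone_class (g i) \<in> B" if "i < n 1" "L i \<noteq> {}" for i
    unfolding B_def using cone.genideal_self[OF sub] that by blast
  have main: "cone_class f \<in> B" if "cone_class f \<in> A" "\<forall>t\<ge>N. ?c t f = 0" for f N
    using that
  proof (induction N arbitrary: f)
    case 0
    then have "f \<in> cone_ideal n"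
      by (simp add: cone_ideal_def)
    then show ?case
      using additive_subgroup.zero_closed[OF ideal.axioms(1)[OF B]] cone_class_zero[of f] by simp
  next
    case (Suc N)
    show ?case
    proof (cases "?c N f = 0")
      case True
      then have "\<forall>t\<ge>N. ?c t f = 0"
        using Suc.prems(2) by (metis le_antisym not_less_eq_eq)
      then show ?thesis
        using Suc.IH Suc.prems(1) by blast
    next
      case False
      define i where "i = N mod n 1"
      have "lead f N"
        unfolding lead_def using False Suc.prems(2) by simp
      then have N: "N \<in> L i"
        using Suc.prems(1) by (auto simp: L_def i_def)
      define s where "s = (LEAST s. s \<in> L i)"
      have "s \<in> L i" "s \<le> N"
        unfolding s_def using N by (auto intro: LeastI Least_le)
      then have "s mod n 1 = N mod n 1"
        by (simp add: L_def i_def)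
      then obtain k where k: "N = s + k * n 1"
        using \<open>s \<le> N\<close> by (metis mod_eq_nat1E mult.commute)
      have i: "i < n 1" "L i \<noteq> {}"
        using n_pos N by (auto simp: i_def)
      note gi = g[OF i(2), folded s_def]
      define a where "a = ?c N f / ?c s (g i)"
      define h where "h = Poly_Mapping.single 0 a * (pvar 1 ^ k * g i)"
      have h: "?c (t + k * n 1) h = a * ?c t (g i)" for t
        unfolding h_def coeff_sum_mult_single using coeff_sum_shift[OF reg, of t k "g i"] by simp
      have "?c t (f - h) = 0" if t: "N \<le> t" for t
      proof -
        obtain u where u: "t = u + k * n 1" "s \<le> u"
          using t k by (intro that[of "t - k * n 1"]) auto
        show ?thesis
        proof (cases "u = s")
          case True
          then have "?c t h = ?c N f" "t = N"
            using h[of s] gi(2) by (simp_all add: u a_def lead_def k)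
          then show ?thesis
            by (simp add: coeff_sum_diff)
        next
          case False
          then have "?c u (g i) = 0" "Suc N \<le> t"
            using gi(2) u k by (auto simp: lead_def)
          then show ?thesis
            using h[of u] Suc.prems(2) by (simp add: coeff_sum_diff u(1))
        qed
      qed
      moreover have "cone_class (f - h) \<in> A"
        unfolding h_def by (intro cone.ideal_minus[OF A] cone.ideal_mult[OF A] Suc.prems(1) gi(1))
      ultimately have "cone_class (f - h) \<in> B"
        using Suc.IH by blast
      moreover have "cone_class h \<in> B"
        unfolding h_def by (intro cone.ideal_mult[OF B] gB i)
      ultimately have "cone_class (f - h + h) \<in> B"
        by (rule cone.ideal_add[OF B])
      then show ?thesis
        by simp
    qed
  qed
  have "cone_class f \<in> B" if f: "cone_class f \<in> A" for f
  proof -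
    obtain N where "\<forall>t\<in>{s. ?c s f \<noteq> 0}. t < N"
      using finite_support[of f] by (auto simp: finite_nat_set_iff_bounded)
    then have "\<forall>t\<ge>N. ?c t f = 0"
      by (auto simp flip: not_le)
    then show ?thesis
      using main f by blast
  qed
  then have "A \<subseteq> B"
    by (rule cone.ideal_subset[OF A])
  moreover have "B \<subseteq> A"
    unfolding B_def by (rule cone.genideal_minimal[OF A]) (use g(1) in auto)
  ultimately show "\<exists>G\<subseteq>carrier ?R. finite G \<and> A = genideal ?R G"
    using sub unfolding B_def by (intro exI[of _ "(\<lambda>i. cone_class (g i)) ` {i. i < n 1 \<and> L i \<noteq> {}}"]) auto
qed

theorem CM_tangent_cone_iff: "CM_tangent_cone (curve_ideal n :: 'k::field poly4 set) \<longleftrightarrow> length_regular"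
proof -
  have "Cohen_Macaulay (poly_ring4 Quot (cone_ideal n :: 'k poly4 set))
      \<longleftrightarrow> (\<forall>f :: 'k poly4. cone_class (line_poly [:0, 1:] * f) = \<zero>\<^bsub>poly_ring4 Quot cone_ideal n\<^esub>
            \<longrightarrow> cone_class f = \<zero>\<^bsub>poly_ring4 Quot cone_ideal n\<^esub>)"
  proof (rule cone.Cohen_Macaulay_iff)
    assume "\<And>f :: 'k poly4. cone_class (line_poly [:0, 1:] * f) = \<zero>\<^bsub>poly_ring4 Quot cone_ideal n\<^esub>
      \<Longrightarrow> cone_class f = \<zero>\<^bsub>poly_ring4 Quot cone_ideal n\<^esub>"
    then have reg: length_regular
      unfolding cone_class_zero line_poly_var using length_regular_iff[where 'k = 'k] by blast
    then show "noetherian_ring (poly_ring4 Quot (cone_ideal n :: 'k poly4 set))"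
      by (rule noetherian_cone)
    show "cone_class f = \<zero>\<^bsub>poly_ring4 Quot cone_ideal n\<^esub>"
      if "p \<noteq> 0" "cone_class (line_poly p * f) = \<zero>\<^bsub>poly_ring4 Quot cone_ideal n\<^esub>" for p and f :: "'k poly4"
      using line_poly_regular[OF reg] that unfolding cone_class_zero by blast
  qed
  also have "\<dots> \<longleftrightarrow> length_regular"
    unfolding cone_class_zero line_poly_var by (rule length_regular_iff)
  finally show ?thesis
    unfolding CM_tangent_cone_def initial_ideal_curve_ideal .
qed

text \<open>
  A monomial of maximal length in its weight either avoids the first variable or is a longest monomial
  times that variable, so only the former can obstruct regularity.
\<close>

lemma length_regular_criterion:
  "length_regular \<longleftrightarrow>
     (\<forall>v u. Poly_Mapping.lookup v 1 = 0 \<and> weight n (mon 1 0 0 0 + u) = weight n v \<longrightarrow>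
        (\<exists>w. weight n (mon 1 0 0 0 + w) = weight n v \<and> mon_deg v \<le> mon_deg (mon 1 0 0 0 + w)))"
proof (intro iffI allI impI; (elim conjE)?)
  fix v u
  assume reg: length_regular and u: "weight n (mon 1 0 0 0 + u) = weight n v"
  obtain l where l: "l \<in> longest n (weight n u)"
    by (rule longest_exists[OF refl])
  moreover have "weight n v = weight n u + n 1"
    using u by (simp add: weight_add)
  ultimately have "mon 1 0 0 0 + l \<in> longest n (weight n v)"
    using reg unfolding length_regular_def by simp
  then show "\<exists>w. weight n (mon 1 0 0 0 + w) = weight n v \<and> mon_deg v \<le> mon_deg (mon 1 0 0 0 + w)"
    by (auto simp: longest_def)
next
  assume *: "\<forall>v u. Poly_Mapping.lookup v 1 = 0 \<and> weight n (mon 1 0 0 0 + u) = weight n v \<longrightarrow>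
        (\<exists>w. weight n (mon 1 0 0 0 + w) = weight n v \<and> mon_deg v \<le> mon_deg (mon 1 0 0 0 + w))"
  show length_regular
    unfolding length_regular_def
  proof (intro allI impI)
    fix s m
    assume m: "m \<in> longest n s"
    have le: "mon_deg (mon 1 0 0 0 + w) \<le> mon_deg (mon 1 0 0 0 + m)"
      if "weight n (mon 1 0 0 0 + w) = s + n 1" for w
      using m that by (simp add: longest_def weight_add mon_deg_add)
    have "mon_deg v \<le> mon_deg (mon 1 0 0 0 + m)" if v: "weight n v = s + n 1" for v
    proof (cases "Poly_Mapping.lookup v 1")
      case 0
      moreover have "weight n (mon 1 0 0 0 + m) = weight n v"
        using m v by (simp add: longest_def weight_add)
      ultimately obtain w where "weight n (mon 1 0 0 0 + w) = weight n v" "mon_deg v \<le> mon_deg (mon 1 0 0 0 + w)"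
        using * by blast
      then show ?thesis
        using le[of w] v by simp
    next
      case (Suc p)
      obtain p' q r t where "v = mon p' q r t"
        by (rule mon_cases)
      then have eq: "v = mon 1 0 0 0 + mon p q r t"
        using Suc by simp
      show ?thesis
        using le[of "mon p q r t"] v unfolding eq by blast
    qed
    then show "mon 1 0 0 0 + m \<in> longest n (s + n 1)"
      using m by (simp add: longest_def weight_add)
  qed
qed

end

section \<open>Connected factorizations\<close>

text \<open>
  For a set \<open>T\<close> of monomials that is closed under the moves \<open>m + u \<leftrightarrow> m + v\<close>, the functional
  \<open>coeff_sum T\<close> annihilates all multiples of the binomials, hence the ideal of the curve, and with it
  the difference of any two monomials of the same weight.
\<close>

lemma moves_connect:
  fixes E :: "((4 \<Rightarrow>\<^sub>0 nat) \<times> (4 \<Rightarrow>\<^sub>0 nat)) set"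
  assumes gen: "genideal poly_ring4 ((\<lambda>(u, v). Poly_Mapping.single u 1 - Poly_Mapping.single v 1) ` E)
      = (curve_ideal n :: 'k::field poly4 set)"
    and closed: "\<And>u v m. (u, v) \<in> E \<Longrightarrow> m + u \<in> T \<longleftrightarrow> m + v \<in> T"
    and "weight n x = weight n y" "x \<in> T"
  shows "y \<in> T"
proof -
  interpret P: presented_ring "poly_ring4 :: 'k poly4 ring" "\<lambda>f. f"
    by (rule poly_ring4_presented)
  define Z where "Z = {f :: 'k poly4. \<forall>h. coeff_sum T (h * f) = 0}"
  have "ideal ((\<lambda>f. f) ` Z) poly_ring4"
  proof (rule P.ideal_image)
    show "f + g \<in> Z" if "f \<in> Z" "g \<in> Z" for f g
      using that by (simp add: Z_def distrib_left coeff_sum_add)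
    show "g * f \<in> Z" if "f \<in> Z" for f g
      using that by (simp add: Z_def flip: mult.assoc)
  qed (simp add: Z_def)
  moreover have "Poly_Mapping.single u 1 - Poly_Mapping.single v 1 \<in> Z" if uv: "(u, v) \<in> E" for u v
  proof -
    have "coeff_sum T (h * (Poly_Mapping.single u 1 - Poly_Mapping.single v 1)) = 0" for h :: "'k poly4"
    proof (induction h rule: poly_mapping_single_induct)
      case (single m a)
      show ?case
        using closed[OF uv, of m] by (simp add: coeff_sum_mult_single coeff_sum_diff coeff_sum_single)
    qed (simp_all add: distrib_right coeff_sum_add)
    then show ?thesis
      by (simp add: Z_def)
  qed
  ultimately have "curve_ideal n \<subseteq> Z"
    unfolding gen[symmetric] by (intro P.genideal_minimal) auto
  moreover have "Poly_Mapping.single x 1 - Poly_Mapping.single y 1 \<in> (curve_ideal n :: 'k poly4 set)"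
    using assms(3) by (simp add: binomial_in_curve_ideal)
  ultimately have "coeff_sum T (1 * (Poly_Mapping.single x 1 - Poly_Mapping.single y 1 :: 'k poly4)) = 0"
    unfolding Z_def by blast
  then show ?thesis
    using assms(4) by (simp add: coeff_sum_diff coeff_sum_single split: if_splits)
qed

section \<open>Five binomial generators\<close>

text \<open>
  The assumption \<open>connected\<close> is what generation of the curve ideal by the five binomials means for
  monomials; in this form the field has disappeared.
\<close>

locale five_binomials = monomial_curve n for n :: "4 \<Rightarrow> nat" +
  fixes a1 a2 a3 a4 a12 a13 a21 a24 a32 a34 a41 a43 :: nat
  assumes n_mono: "n 2 < n 3" "n 3 < n 4"
    and exp_pos: "0 < a21" "0 < a41" "0 < a12" "0 < a32" "0 < a13" "0 < a43" "0 < a24" "0 < a34"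
    and exp_sum: "a1 = a21 + a41" "a2 = a12 + a32" "a3 = a13 + a43" "a4 = a24 + a34"
    and a24_le: "a24 \<le> a34"
    and weights:
      "a1 * n 1 = a12 * n 2 + a13 * n 3" "a2 * n 2 = a21 * n 1 + a24 * n 4"
      "a3 * n 3 = a32 * n 2 + a34 * n 4" "a4 * n 4 = a41 * n 1 + a43 * n 3"
      "a41 * n 1 + a32 * n 2 = a13 * n 3 + a24 * n 4"
    and connected: "\<And>P x y.
      (\<And>p q r t. P (mon (p + a1) q r t) \<longleftrightarrow> P (mon p (q + a12) (r + a13) t)) \<Longrightarrow>
      (\<And>p q r t. P (mon p (q + a2) r t) \<longleftrightarrow> P (mon (p + a21) q r (t + a24))) \<Longrightarrow>
      (\<And>p q r t. P (mon p q (r + a3) t) \<longleftrightarrow> P (mon p (q + a32) r (t + a34))) \<Longrightarrow>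
      (\<And>p q r t. P (mon p q r (t + a4)) \<longleftrightarrow> P (mon (p + a41) q (r + a43) t)) \<Longrightarrow>
      (\<And>p q r t. P (mon (p + a41) (q + a32) r t) \<longleftrightarrow> P (mon p q (r + a13) (t + a24))) \<Longrightarrow>
      weight n x = weight n y \<Longrightarrow> P x \<Longrightarrow> P y"
begin

text \<open>
  Since the weights increase, trading the side of such a relation that avoids the first variable for
  the other side replaces heavier variables by lighter ones, hence needs at least as many of them.
\<close>

lemma automatic_lengthening:
  "a12 + a13 \<le> a1" "a4 \<le> a41 + a43" "a13 + a24 \<le> a41 + a32"
proof -
  have "(a12 + a13) * n 1 \<le> a12 * n 2 + a13 * n 3"
    unfolding distrib_right using n_min by (intro add_mono mult_le_mono2) auto
  then have "(a12 + a13) * n 1 \<le> a1 * n 1"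
    by (simp add: weights(1))
  then show "a12 + a13 \<le> a1"
    using n_pos by simp
  have "a41 * n 1 + a43 * n 3 \<le> (a41 + a43) * n 4"
    unfolding distrib_right using n_min n_mono by (intro add_mono mult_le_mono2) auto
  then have "a4 * n 4 \<le> (a41 + a43) * n 4"
    by (simp add: weights(4))
  then show "a4 \<le> a41 + a43"
    using n_mono by simp
  have "(a13 + a24) * n 2 \<le> a13 * n 3 + a24 * n 4"
    unfolding distrib_right using n_mono by (intro add_mono mult_le_mono2) auto
  also have "\<dots> \<le> (a41 + a32) * n 2"
    unfolding weights(5)[symmetric] distrib_right using n_min by (intro add_mono mult_le_mono2) auto
  finally show "a13 + a24 \<le> a41 + a32"
    using n_min by simp
qed

text \<open>
  Without the first variable, only the third relation can be applied outside the monomial ideal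
  with the five generators below. The last of them arises from the fourth by the third relation, and
  \<open>a24 \<le> a34\<close> is what makes the exponent \<open>a3 + a13\<close> suffice.
\<close>

lemma avoiding_first_variable:
  assumes "weight n (mon (Suc p') q' r' t') = weight n (mon 0 q r t)"
  shows "(a12 \<le> q \<and> a13 \<le> r) \<or> a2 \<le> q \<or> a4 \<le> t \<or> (a13 \<le> r \<and> a24 \<le> t) \<or> a3 + a13 \<le> r"
proof -
  define P where "P m \<longleftrightarrow> 0 < Poly_Mapping.lookup m 1 \<or>
    (a12 \<le> Poly_Mapping.lookup m 2 \<and> a13 \<le> Poly_Mapping.lookup m 3) \<or> a2 \<le> Poly_Mapping.lookup m 2 \<or>
    a4 \<le> Poly_Mapping.lookup m 4 \<or> (a13 \<le> Poly_Mapping.lookup m 3 \<and> a24 \<le> Poly_Mapping.lookup m 4) \<or>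
    a3 + a13 \<le> Poly_Mapping.lookup m (3 :: 4)" for m
  have "P (mon 0 q r t)"
  proof (rule connected[of P])
    show "weight n (mon (Suc p') q' r' t') = weight n (mon 0 q r t)"
      by (rule assms)
    show "P (mon (Suc p') q' r' t')"
      by (simp add: P_def)
    show "P (mon p q (r + a3) t) \<longleftrightarrow> P (mon p (q + a32) r (t + a34))" for p q r t
      unfolding P_def lookup_mon using exp_sum a24_le by arith
  qed (use exp_pos exp_sum(1) in \<open>auto simp: P_def\<close>)
  then show ?thesis
    by (simp add: P_def)
qed

lemma lengthen:
  assumes "weight n (mon p q r t) = weight n g" "mon_deg g \<le> mon_deg (mon p q r t)" "0 < p"
  shows "\<exists>w. weight n (mon 1 0 0 0 + w) = weight n (g + h) \<and> mon_deg (g + h) \<le> mon_deg (mon 1 0 0 0 + w)"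
proof -
  have "mon 1 0 0 0 + (mon (p - 1) q r t + h) = mon p q r t + h"
    using assms(3) by (simp flip: add.assoc)
  then show ?thesis
    using assms(1,2) by (intro exI[of _ "mon (p - 1) q r t + h"]) (simp add: weight_add mon_deg_add)
qed

text \<open>
  Each of the five generators of the monomial ideal is exchanged for a monomial of the same weight that
  contains the first variable and is at least as long.
\<close>

lemma sufficient:
  assumes c1: "a2 \<le> a21 + a24"
    and c2: "(a32 < a12 \<and> a3 + a13 \<le> a41 + 2 * a32 + (a34 - a24)) \<or>
      (a12 \<le> a32 \<and> a3 + a13 \<le> a1 + (a32 - a12) + a34)"
  shows length_regular
  unfolding length_regular_criterion
proof (intro allI impI, elim conjE)
  fix v u
  assume v1: "Poly_Mapping.lookup v 1 = 0" and u: "weight n (mon 1 0 0 0 + u) = weight n v"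
  obtain q r t where v: "v = mon 0 q r t"
    using v1 by (metis mon_cases lookup_mon(1))
  obtain p' q' r' t' where u': "u = mon p' q' r' t'"
    by (rule mon_cases)
  have "weight n (mon (Suc p') q' r' t') = weight n (mon 0 q r t)"
    using u unfolding u' v by simp
  then consider "a12 \<le> q \<and> a13 \<le> r" | "a2 \<le> q" | "a4 \<le> t" | "a13 \<le> r \<and> a24 \<le> t" | "a3 + a13 \<le> r"
    using avoiding_first_variable by blast
  then show "\<exists>w. weight n (mon 1 0 0 0 + w) = weight n v \<and> mon_deg v \<le> mon_deg (mon 1 0 0 0 + w)"
  proof cases
    case 1
    then have "v = mon 0 a12 a13 0 + mon 0 (q - a12) (r - a13) t"
      by (simp add: v)
    then show ?thesis
      using lengthen[of a1 0 0 0 "mon 0 a12 a13 0" "mon 0 (q - a12) (r - a13) t"]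
        weights(1) automatic_lengthening(1) exp_pos exp_sum by simp
  next
    case 2
    then have "v = mon 0 a2 0 0 + mon 0 (q - a2) r t"
      by (simp add: v)
    then show ?thesis
      using lengthen[of a21 0 0 a24 "mon 0 a2 0 0" "mon 0 (q - a2) r t"] weights(2) c1 exp_pos by simp
  next
    case 3
    then have "v = mon 0 0 0 a4 + mon 0 q r (t - a4)"
      by (simp add: v)
    then show ?thesis
      using lengthen[of a41 0 a43 0 "mon 0 0 0 a4" "mon 0 q r (t - a4)"]
        weights(4) automatic_lengthening(2) exp_pos by simp
  next
    case 4
    then have "v = mon 0 0 a13 a24 + mon 0 q (r - a13) (t - a24)"
      by (simp add: v)
    then show ?thesis
      using lengthen[of a41 a32 0 0 "mon 0 0 a13 a24" "mon 0 q (r - a13) (t - a24)"]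
        weights(5) automatic_lengthening(3) exp_pos by simp
  next
    case 5
    then have eq: "v = mon 0 0 (a3 + a13) 0 + mon 0 q (r - (a3 + a13)) t"
      by (simp add: v)
    show ?thesis
    proof (cases "a12 \<le> a32")
      \<comment> \<open>The third relation makes the second variable available, then the first relation applies.\<close>
      case True
      then obtain e where e: "a32 = a12 + e"
        using le_Suc_ex by blast
      have "a1 * n 1 + e * n 2 + a34 * n 4 = (a3 + a13) * n 3"
        using weights(1,3) unfolding e by (simp add: distrib_right)
      then show ?thesis
        unfolding eq using lengthen[of a1 e 0 a34 "mon 0 0 (a3 + a13) 0" "mon 0 q (r - (a3 + a13)) t"]
          c2 e exp_pos exp_sum by simp
    next
      \<comment> \<open>The third relation, then the fifth, which is possible because of \<open>a24 \<le> a34\<close>.\<close>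
      case False
      obtain e where e: "a34 = a24 + e"
        using le_Suc_ex[OF a24_le] by blast
      have "a41 * n 1 + 2 * a32 * n 2 + e * n 4 = (a3 + a13) * n 3"
        using weights(3,5) unfolding e by (simp add: distrib_right)
      then show ?thesis
        unfolding eq using lengthen[of a41 "2 * a32" 0 e "mon 0 0 (a3 + a13) 0" "mon 0 q (r - (a3 + a13)) t"]
          c2 e False exp_pos by simp
    qed
  qed
qed

text \<open>Neither side of the second relation is divisible by a side of another relation.\<close>

lemma factorizations_second:
  assumes "weight n m = weight n (mon 0 a2 0 0)"
  shows "m = mon 0 a2 0 0 \<or> m = mon a21 0 0 a24"
  by (rule connected[of "\<lambda>m. m = mon 0 a2 0 0 \<or> m = mon a21 0 0 a24" "mon 0 a2 0 0"])
    (use assms exp_pos exp_sum in auto)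

text \<open>
  Starting at \<open>x\<^sub>3\<^bsup>a3 + a13\<^esup>\<close>, only the third relation applies, then only the fifth or, for
  \<open>a12 \<le> a32\<close>, the first. From there on only the second relation leads further, and \<open>k\<close> counts how
  often it has been applied after the fifth. The two monomials reached by the fifth and the first relation are
  themselves joined by the second, so the path closes up.
\<close>

lemma factorizations_third:
  assumes "weight n (mon p q r t) = weight n (mon 0 0 (a3 + a13) 0)" "0 < p"
  shows "(\<exists>k. p + k * a21 = a41 \<and> q = 2 * a32 + k * a2 \<and> r = 0 \<and> t + (k + 1) * a24 = a34) \<or>
    (a12 \<le> a32 \<and> p = a1 \<and> q = a32 - a12 \<and> r = 0 \<and> t = a34)"
proof -
  define P where "P p q r t \<longleftrightarrow>
    (p = 0 \<and> q = 0 \<and> r = a3 + a13 \<and> t = 0) \<or> (p = 0 \<and> q = a32 \<and> r = a13 \<and> t = a34) \<or>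
    (\<exists>k. p + k * a21 = a41 \<and> q = 2 * a32 + k * a2 \<and> r = 0 \<and> t + (k + 1) * a24 = a34) \<or>
    (a12 \<le> a32 \<and> p = a1 \<and> q = a32 - a12 \<and> r = 0 \<and> t = a34)" for p q r t
  define P' where "P' m = P (Poly_Mapping.lookup m 1) (Poly_Mapping.lookup m 2)
    (Poly_Mapping.lookup m 3) (Poly_Mapping.lookup m (4 :: 4))" for m
  have P': "P' (mon p q r t) \<longleftrightarrow> P p q r t" for p q r t
    by (simp add: P'_def)
  have "P' (mon p q r t)"
  proof (rule connected[of P'], unfold P')
    show "weight n (mon 0 0 (a3 + a13) 0) = weight n (mon p q r t)"
      using assms(1) by simp
    show "P' (mon 0 0 (a3 + a13) 0)"
      unfolding P' by (simp add: P_def)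
    fix p q r t
    show "P (p + a1) q r t \<longleftrightarrow> P p (q + a12) (r + a13) t"
      unfolding P_def using exp_pos exp_sum by auto
    show "P p q (r + a3) t \<longleftrightarrow> P p (q + a32) r (t + a34)"
      unfolding P_def using exp_pos exp_sum by auto
    show "P p q r (t + a4) \<longleftrightarrow> P (p + a41) q (r + a43) t"
      unfolding P_def using exp_pos exp_sum by auto
    show "P (p + a41) (q + a32) r t \<longleftrightarrow> P p q (r + a13) (t + a24)"
      unfolding P_def using exp_pos exp_sum by auto
    show "P p (q + a2) r t \<longleftrightarrow> P (p + a21) q r (t + a24)"
    proof
      assume "P p (q + a2) r t"
      then obtain k where k: "p + k * a21 = a41" "q + a2 = 2 * a32 + k * a2" "r = 0" "t + (k + 1) * a24 = a34"
        unfolding P_def using exp_pos exp_sum by auto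
      show "P (p + a21) q r (t + a24)"
      proof (cases k)
        case 0
        then show ?thesis
          unfolding P_def using k exp_sum by auto
      next
        case (Suc j)
        then have "p + a21 + j * a21 = a41 \<and> q = 2 * a32 + j * a2 \<and> r = 0 \<and> t + a24 + (j + 1) * a24 = a34"
          using k by (simp add: algebra_simps)
        then show ?thesis
          unfolding P_def by blast
      qed
    next
      assume "P (p + a21) q r (t + a24)"
      then consider k where "p + a21 + k * a21 = a41" "q = 2 * a32 + k * a2" "r = 0" "t + a24 + (k + 1) * a24 = a34"
        | "a12 \<le> a32" "p + a21 = a1" "q = a32 - a12" "r = 0" "t + a24 = a34"
        unfolding P_def using exp_pos by auto
      then show "P p (q + a2) r t"
      proof cases
        case (1 k)
        then have "p + (k + 1) * a21 = a41 \<and> q + a2 = 2 * a32 + (k + 1) * a2 \<and> r = 0 \<and> t + (k + 1 + 1) * a24 = a34"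
          by (simp add: algebra_simps)
        then show ?thesis
          unfolding P_def by blast
      next
        case 2
        then have "p + 0 * a21 = a41 \<and> q + a2 = 2 * a32 + 0 * a2 \<and> r = 0 \<and> t + (0 + 1) * a24 = a34"
          using exp_sum by auto
        then show ?thesis
          unfolding P_def by blast
      qed
    qed
  qed
  then show ?thesis
    unfolding P' P_def using assms(2) by blast
qed

text \<open>
  Regularity is tested on \<open>x\<^sub>2\<^bsup>a2\<^esup>\<close> and \<open>x\<^sub>3\<^bsup>a3 + a13\<^esup>\<close>. For the
  latter, the first condition says that introducing \<open>x\<^sub>2\<^bsup>a2\<^esup>\<close> by the second relation never lengthens a
  monomial, so the longest candidate is at the start of the chain of its applications.
\<close>

lemma necessary:
  assumes reg: length_regular
  shows "a2 \<le> a21 + a24"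
    and "(a32 < a12 \<and> a3 + a13 \<le> a41 + 2 * a32 + (a34 - a24)) \<or>
      (a12 \<le> a32 \<and> a3 + a13 \<le> a1 + (a32 - a12) + a34)"
proof -
  have ex: "\<exists>p q r t. 0 < p \<and> weight n (mon p q r t) = weight n (mon 0 i j k) \<and> i + j + k \<le> p + q + r + t"
    if "weight n (mon p' q' r' t') = weight n (mon 0 i j k)" "0 < p'" for p' q' r' t' i j k
  proof -
    have "weight n (mon 1 0 0 0 + mon (p' - 1) q' r' t') = weight n (mon 0 i j k)"
      using that by (simp del: weight_mon)
    moreover have "Poly_Mapping.lookup (mon 0 i j k) 1 = 0"
      by simp
    ultimately obtain w where w: "weight n (mon 1 0 0 0 + w) = weight n (mon 0 i j k)"
      "mon_deg (mon 0 i j k) \<le> mon_deg (mon 1 0 0 0 + w)"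
      using reg unfolding length_regular_criterion by blast
    obtain p q r t where "w = mon p q r t"
      by (rule mon_cases)
    then show ?thesis
      using w by (intro exI[of _ "Suc p"] exI[of _ q] exI[of _ r] exI[of _ t]) (simp del: weight_mon)
  qed
  obtain p q r t where m: "0 < p" "weight n (mon p q r t) = weight n (mon 0 a2 0 0)" "a2 \<le> p + q + r + t"
    using ex[of a21 0 0 a24 a2 0 0] weights(2) exp_pos by auto
  then have "mon p q r t = mon a21 0 0 a24"
    using factorizations_second[OF m(2)] by auto
  then show c1: "a2 \<le> a21 + a24"
    using m(3) by simp
  obtain e where e: "a34 = a24 + e"
    using le_Suc_ex[OF a24_le] by blast
  have "weight n (mon a41 (2 * a32) 0 e) = weight n (mon 0 0 (a3 + a13) 0)"
    using weights(3,5) unfolding e by (simp add: distrib_right)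
  then obtain p q r t where m: "0 < p" "weight n (mon p q r t) = weight n (mon 0 0 (a3 + a13) 0)"
    "a3 + a13 \<le> p + q + r + t"
    using ex[of a41 "2 * a32" 0 e 0 "a3 + a13" 0] exp_pos by auto
  from factorizations_third[OF m(2,1)]
  show "(a32 < a12 \<and> a3 + a13 \<le> a41 + 2 * a32 + (a34 - a24)) \<or>
      (a12 \<le> a32 \<and> a3 + a13 \<le> a1 + (a32 - a12) + a34)"
  proof (elim disjE exE conjE)
    fix k
    assume k: "p + k * a21 = a41" "q = 2 * a32 + k * a2" "r = 0" "t + (k + 1) * a24 = a34"
    have "k * a2 \<le> k * a21 + k * a24"
      using mult_le_mono2[OF c1, of k] by (simp add: distrib_left)
    then have "a3 + a13 \<le> a41 + 2 * a32 + (a34 - a24)"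
      using m(3) k by (simp add: distrib_right)
    then show ?thesis
      using c1 exp_sum a24_le by linarith
  next
    assume "a12 \<le> a32" "p = a1" "q = a32 - a12" "r = 0" "t = a34"
    then show ?thesis
      using m(3) by simp
  qed
qed

end

theorem theorem3p25:
  fixes n :: "4 \<Rightarrow> nat"
    and I :: "'k::field poly4 set"
    and a1 a2 a3 a4 a12 a13 a21 a24 a32 a34 a41 a43 :: nat
    and f1 f2 f3 f4 f5 :: "'k poly4"
  assumes n_pos: "\<And>i. 0 < n i"
    and n_gcd: "gcd (n 1) (gcd (n 2) (gcd (n 3) (n 4))) = 1"
    and n_less: "n 1 < n 2" "n 2 < n 3" "n 3 < n 4"
    and I_eq: "I = curve_ideal n"
    and not_ci: "\<not> complete_intersection_curve I"
    and gorenstein: "Gorenstein_curve n"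
    and exp1: "0 < a21" "a21 < a1" "0 < a41" "a41 < a1"
    and exp2: "0 < a12" "a12 < a2" "0 < a32" "a32 < a2"
    and exp3: "0 < a13" "a13 < a3" "0 < a43" "a43 < a3"
    and exp4: "0 < a24" "a24 < a4" "0 < a34" "a34 < a4"
    and bresinsky: "a1 = a21 + a41" "a2 = a12 + a32" "a3 = a13 + a43" "a4 = a24 + a34"
    and f1: "f1 = pvar 1 ^ a1 - pvar 2 ^ a12 * pvar 3 ^ a13"
    and f2: "f2 = pvar 2 ^ a2 - pvar 1 ^ a21 * pvar 4 ^ a24"
    and f3: "f3 = pvar 3 ^ a3 - pvar 2 ^ a32 * pvar 4 ^ a34"
    and f4: "f4 = pvar 4 ^ a4 - pvar 1 ^ a41 * pvar 3 ^ a43"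
    and f5: "f5 = pvar 1 ^ a41 * pvar 2 ^ a32 - pvar 3 ^ a13 * pvar 4 ^ a24"
    and min_gen: "minimally_generates poly_ring4 {f1, f2, f3, f4, f5} I"
    and a24_le: "a24 \<le> a34"
  shows "CM_tangent_cone I \<longleftrightarrow>
    a2 \<le> a21 + a24 \<and>
    ((a32 < a12 \<and> a3 + a13 \<le> a41 + 2 * a32 + (a34 - a24)) \<or>
     (a12 \<le> a32 \<and> a3 + a13 \<le> a1 + (a32 - a12) + a34))"
proof -
  note exps = exp1 exp2 exp3 exp4
  define E where "E = {(mon a1 0 0 0, mon 0 a12 a13 0), (mon 0 a2 0 0, mon a21 0 0 a24),
    (mon 0 0 a3 0, mon 0 a32 0 a34), (mon 0 0 0 a4, mon a41 0 a43 0),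
    (mon a41 a32 0 0, mon 0 0 a13 a24)}"
  define F :: "'k poly4 set" where "F = (\<lambda>(u, v). Poly_Mapping.single u 1 - Poly_Mapping.single v 1) ` E"
  have F: "{f1, f2, f3, f4, f5} = F"
    by (simp add: F_def E_def f1 f2 f3 f4 f5 pvar_power mult_single mon_single)
  have gen: "genideal poly_ring4 F = curve_ideal n"
    using min_gen by (simp add: minimally_generates_def I_eq F)
  interpret P: presented_ring "poly_ring4 :: 'k poly4 ring" "\<lambda>f. f"
    by (rule poly_ring4_presented)
  have "F \<subseteq> curve_ideal n"
    unfolding gen[symmetric] using P.closed by (intro P.genideal_self) auto
  then have "\<forall>(u, v)\<in>E. weight n u = weight n v"
    using binomial_in_curve_ideal[where 'k = 'k] unfolding F_def by blast
  then have weights: "a1 * n 1 = a12 * n 2 + a13 * n 3" "a2 * n 2 = a21 * n 1 + a24 * n 4"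
      "a3 * n 3 = a32 * n 2 + a34 * n 4" "a4 * n 4 = a41 * n 1 + a43 * n 3"
      "a41 * n 1 + a32 * n 2 = a13 * n 3 + a24 * n 4"
    by (simp_all add: E_def)
  interpret five_binomials n a1 a2 a3 a4 a12 a13 a21 a24 a32 a34 a41 a43
  proof
    fix P x y
    assume closed:
      "\<And>p q r t. P (mon (p + a1) q r t) \<longleftrightarrow> P (mon p (q + a12) (r + a13) t)"
      "\<And>p q r t. P (mon p (q + a2) r t) \<longleftrightarrow> P (mon (p + a21) q r (t + a24))"
      "\<And>p q r t. P (mon p q (r + a3) t) \<longleftrightarrow> P (mon p (q + a32) r (t + a34))"
      "\<And>p q r t. P (mon p q r (t + a4)) \<longleftrightarrow> P (mon (p + a41) q (r + a43) t)"
      "\<And>p q r t. P (mon (p + a41) (q + a32) r t) \<longleftrightarrow> P (mon p q (r + a13) (t + a24))"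
      and xy: "weight n x = weight n y" "P x"
    have "y \<in> Collect P"
    proof (rule moves_connect[OF gen[unfolded F_def] _ xy(1)])
      fix u v m
      assume uv: "(u, v) \<in> E"
      obtain p q r t where "m = mon p q r t"
        by (rule mon_cases)
      then show "m + u \<in> Collect P \<longleftrightarrow> m + v \<in> Collect P"
        using uv closed by (auto simp: E_def)
    qed (use xy(2) in simp)
    then show "P y"
      by simp
  qed (use n_pos n_less exps bresinsky a24_le weights in auto)
  show ?thesis
    unfolding I_eq CM_tangent_cone_iff using sufficient necessary by blast
qed

end
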